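(* Let $n$ and $d$ be positive integers and let $\gamma : [n]\times[n] \to \mathbb{F}_2^{d}$ be simple cycle free. Then $d \ge n/2 - 2$.
   Context: $[n]=\{1,\ldots,n\}$. The complete bipartite graph $K_{n,n}$ has two disjoint vertex classes, each a copy of $[n]$, and its edges are identified with the pairs $(x,y)\in[n]\times[n]$ ($x$ in the first class, $y$ in the second). A function $\gamma:[n]\times[n]\to\mathbb{F}_2^d$ is thus a labeling of the edges of $K_{n,n}$. The labeling $\gamma$ is called simple cycle free if for every simple cycle $C$ in $K_{n,n}$ (a closed walk with no repeated vertices, of length $2k$ with $k\ge 2$) one has $\sum_{e\in C}\gamma(e)\neq 0$ in $\mathbb{F}_2^d$, the sum being over the edges of $C$. *)

theory Defs
  imports "HOL-Analysis.Finite_Cartesian_Product" "HOL-Library.Z2"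
begin

text \<open>
  The vertices of \<open>K\<^sub>n\<^sub>,\<^sub>n\<close> are \<open>Inl x\<close> and \<open>Inr y\<close> with \<open>x\<close> and \<open>y\<close> in \<open>{1..n}\<close>; the edge
  joining \<open>Inl x\<close> and \<open>Inr y\<close> is identified with the pair \<open>(x, y)\<close>.
\<close>

definition Knn_edges :: "nat \<Rightarrow> (nat \<times> nat) set" where
  "Knn_edges n = {1..n} \<times> {1..n}"

definition ends :: "nat \<times> nat \<Rightarrow> (nat + nat) set" where
  "ends e = {Inl (fst e), Inr (snd e)}"

text \<open>
  A closed walk is given by its list of vertices, the first vertex not being repeated at the end.
  Membership of the vertices in \<open>K\<^sub>n\<^sub>,\<^sub>n\<close> follows from the adjacency condition.
\<close>

definition cycle_step :: "(nat + nat) list \<Rightarrow> nat \<Rightarrow> (nat + nat) set" where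
  "cycle_step vs i = {vs ! i, vs ! (Suc i mod length vs)}"

definition simple_cycle :: "nat \<Rightarrow> (nat + nat) list \<Rightarrow> bool" where
  "simple_cycle n vs \<longleftrightarrow>
     (\<exists>k\<ge>2. length vs = 2 * k) \<and> distinct vs \<and>
     (\<forall>i<length vs. \<exists>e\<in>Knn_edges n. ends e = cycle_step vs i)"

definition cycle_edges :: "nat \<Rightarrow> (nat + nat) list \<Rightarrow> (nat \<times> nat) set" where
  "cycle_edges n vs = {e \<in> Knn_edges n. \<exists>i<length vs. ends e = cycle_step vs i}"

text \<open>
  \<open>\<gamma>\<close> is a total function, but only its values on \<open>Knn_edges n\<close> matter. The type
  \<open>bit ^ 'd\<close> is the vector space over the two-element field of dimension \<open>CARD('d)\<close>.
\<close>

definition simple_cycle_free :: "nat \<Rightarrow> (nat \<times> nat \<Rightarrow> bit ^ 'd) \<Rightarrow> bool" where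
  "simple_cycle_free n \<gamma> \<longleftrightarrow>
     (\<forall>vs. simple_cycle n vs \<longrightarrow> (\<Sum>e\<in>cycle_edges n vs. \<gamma> e) \<noteq> 0)"

end

theory Submission
  imports Defs "HOL-Combinatorics.Cycles"
begin

text \<open>
  Permutations are sorted into classes according to the sum of the labels of the corresponding
  perfect matching and to the parity. Two members of a class never differ by a single cycle,
  because the symmetric difference of the two matchings would be a simple cycle with label sum 0.
  So it suffices to show that a class \<open>S\<close> of bijections between \<open>n\<close>-sets with these properties has
  at most \<open>n! / 2 ^ k\<close> members, where \<open>n\<close> is \<open>2 * k + 1\<close> or \<open>2 * k + 2\<close>.

  Let \<open>S\<close> act on the exterior algebra of \<open>\<real>\<^sup>n\<close> by its sum over all members, and let
  \<open>L S\<close> be the square of the Hilbert-Schmidt norm of this operator. In terms of characters of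
  the symmetric group, \<open>L S = 2 * (h\<^sub>0 + \<dots> + h\<^sub>n\<^sub>-\<^sub>1)\<close>, where \<open>h\<^sub>j \<ge> 0\<close> is the contribution of the
  hook shape \<open>(n - j, 1\<^sup>j)\<close>. The alternating sum of the hook characters is supported on
  the \<open>n\<close>-cycles, hence the alternating sum of the \<open>h\<^sub>j\<close> vanishes, and for odd \<open>n\<close> this gives
  \<open>L S \<ge> 4 * (h\<^sub>0 + h\<^sub>n\<^sub>-\<^sub>1) = 8 * (card S)\<^sup>2\<close>. In the other direction, induction of hook
  representations from \<open>n - 1\<close> to \<open>n\<close> points gives
  \<open>2 * L S \<le> 4 * (card S)\<^sup>2 + (\<Sum>x y. L {p \<in> S. p x = y})\<close>. Both
  inequalities together bound \<open>card S\<close> by induction on \<open>n\<close>.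
\<close>

section \<open>Signs and the exterior algebra\<close>

text \<open>For x outside \<open>I\<close>, this is the sign of moving x into place after appending
  it to the increasing list of \<open>I\<close>. It relates the wedge product of \<open>I\<close>
  followed by x to the basis vector of \<open>insert x I\<close>.\<close>

definition shuffle_sign :: "'a::linorder \<Rightarrow> 'a set \<Rightarrow> real" where
  "shuffle_sign x I = (-1) ^ card {a \<in> I. x < a}"

text \<open>For p injective on \<open>I\<close>, this is the nonzero minor of the matrix of p on the
  columns \<open>I\<close>. Domain and target carry separate orders, so p need not be a
  permutation.\<close>

definition inversion_sign :: "('a::linorder \<Rightarrow> 'b::linorder) \<Rightarrow> 'a set \<Rightarrow> real" where
  "inversion_sign p I = (-1) ^ card {(a, b). a \<in> I \<and> b \<in> I \<and> a < b \<and> p b < p a}"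

lemma shuffle_sign_sq [simp]: "shuffle_sign x I * shuffle_sign x I = 1"
  unfolding shuffle_sign_def by (simp flip: power_add mult_2)

lemma shuffle_sign_mult_cancel [simp]: "shuffle_sign x I * (shuffle_sign x I * c) = c"
  by (simp flip: mult.assoc)

lemma shuffle_sign_cases: "shuffle_sign x I = 1 \<or> shuffle_sign x I = -1"
  unfolding shuffle_sign_def by (simp add: minus_one_power_iff)

lemma inversion_sign_sq [simp]: "inversion_sign p I * inversion_sign p I = 1"
  unfolding inversion_sign_def by (simp flip: power_add mult_2)

lemma inversion_sign_cases: "inversion_sign p I = 1 \<or> inversion_sign p I = -1"
  unfolding inversion_sign_def by (simp add: minus_one_power_iff)

lemma inversion_sign_empty [simp]: "inversion_sign p {} = 1"
  unfolding inversion_sign_def by simp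

lemma inversion_sign_cong:
  assumes "\<And>a. a \<in> I \<Longrightarrow> p a = q a"
  shows "inversion_sign p I = inversion_sign q I"
proof -
  have "{(a, b). a \<in> I \<and> b \<in> I \<and> a < b \<and> p b < p a} = {(a, b). a \<in> I \<and> b \<in> I \<and> a < b \<and> q b < q a}"
    using assms by auto
  then show ?thesis unfolding inversion_sign_def by simp
qed

lemma shuffle_sign_insert:
  assumes "finite I" "y \<notin> I"
  shows "shuffle_sign x (insert y I) = (if x < y then - shuffle_sign x I else shuffle_sign x I)"
proof (cases "x < y")
  case True
  then have "{a \<in> insert y I. x < a} = insert y {a \<in> I. x < a}" by auto
  then show ?thesis using assms True by (simp add: shuffle_sign_def)
next
  case False
  then have "{a \<in> insert y I. x < a} = {a \<in> I. x < a}" by auto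
  then show ?thesis using False by (simp add: shuffle_sign_def)
qed

lemma shuffle_sign_swap:
  assumes "finite I" "x \<notin> I" "y \<notin> I" "x \<noteq> y"
  shows "shuffle_sign x (insert y I) * shuffle_sign y I = - (shuffle_sign y (insert x I) * shuffle_sign x I)"
  using assms by (auto simp: shuffle_sign_insert)

text \<open>The new inversions all involve x. With \<open>U\<close> and \<open>V\<close> the members
  of \<open>I\<close> that lie above x before and after applying p, they are indexed by the
  symmetric difference of \<open>U\<close> and \<open>V\<close>, whose size has the parity of
  \<open>card U + card V\<close>.\<close>

lemma inversion_sign_insert:
  assumes fin: "finite I" and x: "x \<notin> I" and inj: "inj_on p (insert x I)"
  shows "inversion_sign p (insert x I) = inversion_sign p I * shuffle_sign x I * shuffle_sign (p x) (p ` I)"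
proof -
  define U where "U = {a \<in> I. x < a}"
  define V where "V = {a \<in> I. p x < p a}"
  define inv where "inv = {(a, b). a \<in> I \<and> b \<in> I \<and> a < b \<and> p b < p a}"
  have finU: "finite U" "finite V" unfolding U_def V_def using fin by auto
  have ne: "p a \<noteq> p x" "a \<noteq> x" if "a \<in> I" for a using inj x that by (auto simp: inj_on_def)
  have "finite inv"
    by (rule finite_subset[of _ "I \<times> I"]) (auto simp: inv_def fin)
  have eq: "{(a, b). a \<in> insert x I \<and> b \<in> insert x I \<and> a < b \<and> p b < p a}
    = inv \<union> (Pair x ` (U - V) \<union> (\<lambda>a. (a, x)) ` (V - U))"
    using x ne by (force simp: inv_def U_def V_def image_iff)
  have "card (inv \<union> (Pair x ` (U - V) \<union> (\<lambda>a. (a, x)) ` (V - U)))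
    = card inv + card (Pair x ` (U - V) \<union> (\<lambda>a. (a, x)) ` (V - U))"
    by (rule card_Un_disjoint) (use \<open>finite inv\<close> finU x in \<open>auto simp: inv_def\<close>)
  also have "card (Pair x ` (U - V) \<union> (\<lambda>a. (a, x)) ` (V - U)) = card (Pair x ` (U - V)) + card ((\<lambda>a. (a, x)) ` (V - U))"
    by (rule card_Un_disjoint) (use finU x in \<open>auto simp: U_def\<close>)
  also have "card (Pair x ` (U - V)) = card (U - V)"
    by (rule card_image) (auto simp: inj_on_def)
  also have "card ((\<lambda>a. (a, x)) ` (V - U)) = card (V - U)"
    by (rule card_image) (auto simp: inj_on_def)
  finally have c: "card {(a, b). a \<in> insert x I \<and> b \<in> insert x I \<and> a < b \<and> p b < p a}
     = card inv + (card (U - V) + card (V - U))" unfolding eq .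
  have U: "card U = card (U - V) + card (U \<inter> V)"
    using card_Int_Diff[of U V] finU by simp
  have V: "card V = card (V - U) + card (U \<inter> V)"
    using card_Int_Diff[of V U] finU by (simp add: Int_commute)
  have "card {b \<in> p ` I. p x < b} = card (p ` V)"
    by (rule arg_cong[where f = card]) (auto simp: V_def)
  also have "\<dots> = card V"
    by (rule card_image) (use inj in \<open>auto simp: V_def inj_on_def\<close>)
  finally have pv: "card {b \<in> p ` I. p x < b} = card V" .
  have "inversion_sign p I * shuffle_sign x I * shuffle_sign (p x) (p ` I) = (-1) ^ (card inv + card U + card V)"
    unfolding inversion_sign_def shuffle_sign_def pv inv_def U_def by (simp add: power_add)
  also have "card inv + card U + card V = (card inv + (card (U - V) + card (V - U))) + 2 * card (U \<inter> V)"
    using U V by simp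
  also have "(-1 :: real) ^ \<dots> = (-1) ^ (card inv + (card (U - V) + card (V - U)))"
    by (simp add: power_add)
  finally show ?thesis unfolding inversion_sign_def c by simp
qed

section \<open>Layers of subsets and the two operators on the exterior algebra\<close>

definition layer :: "'a set \<Rightarrow> nat \<Rightarrow> 'a set set" where
  "layer X j = {I. I \<subseteq> X \<and> card I = j}"

lemma finite_layer [simp]: "finite X \<Longrightarrow> finite (layer X j)"
  unfolding layer_def by (rule finite_subset[of _ "Pow X"]) auto

lemma sum_layer_Suc:
  assumes "finite X"
  shows "(\<Sum>J\<in>layer X (Suc j). \<Sum>y\<in>J. F y (J - {y})) = (\<Sum>J\<in>layer X j. \<Sum>y\<in>X - J. F y J)"
proof -
  have fin: "finite J" if "J \<subseteq> X" for J using assms that finite_subset by blast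
  have "(\<Sum>J\<in>layer X (Suc j). \<Sum>y\<in>J. F y (J - {y})) = (\<Sum>(J, y)\<in>Sigma (layer X (Suc j)) (\<lambda>J. J). F y (J - {y}))"
    by (rule sum.Sigma) (use assms fin in \<open>auto simp: layer_def\<close>)
  also have "\<dots> = (\<Sum>(J, y)\<in>Sigma (layer X j) (\<lambda>J. X - J). F y J)"
    by (rule sum.reindex_bij_witness[where i = "\<lambda>(J, y). (insert y J, y)" and j = "\<lambda>(J, y). (J - {y}, y)"])
      (use fin in \<open>auto simp: layer_def card_insert_if insert_absorb\<close>)
  also have "\<dots> = (\<Sum>J\<in>layer X j. \<Sum>y\<in>X - J. F y J)"
    by (rule sum.Sigma[symmetric]) (use assms in \<open>auto\<close>)
  finally show ?thesis .
qed

text \<open>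
  Functions on finite sets are elements of the exterior algebra, a set being the wedge product of
  its members in increasing order. Both operations below belong to the vector \<open>e\<close> with all
  coordinates 1: \<open>wedge\<close> is the exterior product with \<open>e\<close> and \<open>contract Y\<close> its adjoint.
\<close>

definition wedge :: "('a::linorder set \<Rightarrow> real) \<Rightarrow> 'a set \<Rightarrow> real" where
  "wedge f J = (\<Sum>y\<in>J. shuffle_sign y (J - {y}) * f (J - {y}))"

definition contract :: "'a::linorder set \<Rightarrow> ('a set \<Rightarrow> real) \<Rightarrow> 'a set \<Rightarrow> real" where
  "contract Y f J = (\<Sum>y\<in>Y - J. shuffle_sign y J * f (insert y J))"

definition ip :: "'a set \<Rightarrow> nat \<Rightarrow> ('a set \<Rightarrow> real) \<Rightarrow> ('a set \<Rightarrow> real) \<Rightarrow> real" where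
  "ip Y j f g = (\<Sum>J\<in>layer Y j. f J * g J)"

lemma sum_layer_Suc_insert:
  assumes "finite X"
  shows "(\<Sum>J\<in>layer X (Suc j). \<Sum>y\<in>J. F y (J - {y}) J) = (\<Sum>J\<in>layer X j. \<Sum>y\<in>X - J. F y J (insert y J))"
  using sum_layer_Suc[OF assms, of "\<lambda>y J. F y J (insert y J)" j] 
  by (simp add: insert_absorb cong: sum.cong)

lemma ip_wedge: 
  assumes "finite Y"
  shows "ip Y (Suc j) (wedge f) g = ip Y j f (contract Y g)"
  using sum_layer_Suc_insert[OF assms, of "\<lambda>y J J'. shuffle_sign y J * f J * g J'"]
  unfolding ip_def wedge_def contract_def by (simp add: sum_distrib_left sum_distrib_right algebra_simps)

text \<open>Two elements y and z can be inserted in either order, and by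
  \<open>shuffle_sign_swap\<close> the two orders carry opposite signs.\<close>

lemma contract_contract:
  assumes "finite Y" "J \<subseteq> Y"
  shows "contract Y (contract Y f) J = 0"
proof -
  have finJ: "finite J" using assms finite_subset by blast
  \<comment> \<open>The value 0 on the diagonal lets y and z range over the same set independently,
    so that exchanging them shows the double sum to be its own negative.\<close>
  define G where "G y z = (if z = y then 0 else shuffle_sign y J * (shuffle_sign z (insert y J) * f (insert z (insert y J))))" for y z
  have "contract Y (contract Y f) J = (\<Sum>y\<in>Y - J. \<Sum>z\<in>Y - J. G y z)"
    unfolding contract_def
  proof (rule sum.cong[OF refl])
    fix y assume y: "y \<in> Y - J"
    have "(\<Sum>z\<in>Y - J. G y z) = (\<Sum>z\<in>Y - J - {y}. G y z)"
      by (rule sum.mono_neutral_right) (use assms y in \<open>auto simp: G_def\<close>)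
    also have "Y - J - {y} = Y - insert y J" by auto
    finally show "shuffle_sign y J * (\<Sum>z\<in>Y - insert y J. shuffle_sign z (insert y J) * f (insert z (insert y J))) = (\<Sum>z\<in>Y - J. G y z)"
      by (simp add: sum_distrib_left G_def) 
  qed
  moreover have "G y z = - G z y" if "y \<in> Y - J" "z \<in> Y - J" for y z
    using shuffle_sign_swap[OF finJ, of y z] that
    by (auto simp: G_def insert_commute simp flip: mult.assoc) (simp add: mult.commute)
  then have "(\<Sum>y\<in>Y - J. \<Sum>z\<in>Y - J. G y z) = (\<Sum>y\<in>Y - J. \<Sum>z\<in>Y - J. - G z y)"
    by (intro sum.cong refl) blast
  then have "(\<Sum>y\<in>Y - J. \<Sum>z\<in>Y - J. G y z) = - (\<Sum>y\<in>Y - J. \<Sum>z\<in>Y - J. G y z)"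
    unfolding sum_negf by (subst (asm) (2) sum.swap) simp
  ultimately show ?thesis by simp
qed

text \<open>This is the anticommutation relation of exterior multiplication and contraction by one
  vector: their anticommutator is the squared length of that vector, here
  \<open>card Y\<close>.\<close>

lemma contract_wedge:
  fixes f :: "'a::linorder set \<Rightarrow> real"
  assumes "finite Y" "J \<subseteq> Y"
  shows "contract Y (wedge f) J = real (card Y) * f J - wedge (contract Y f) J"
proof -
  have finJ: "finite J" using assms finite_subset by blast
  \<comment> \<open>\<open>G y z\<close> is the term that removes z and inserts y. It occurs in both
    compositions with opposite signs, so only the diagonal terms \<open>f J\<close> survive, one for
    each element of \<open>Y\<close>.\<close>
  define G where "G y z = shuffle_sign y J * (shuffle_sign z (insert y (J - {z})) * f (insert y (J - {z})))" for y z
  have 1: "contract Y (wedge f) J = (\<Sum>y\<in>Y - J. f J + (\<Sum>z\<in>J. G y z))"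
    unfolding contract_def
  proof (rule sum.cong[OF refl])
    fix y assume y: "y \<in> Y - J"
    have "wedge f (insert y J) = shuffle_sign y J * f J + (\<Sum>z\<in>J. shuffle_sign z (insert y (J - {z})) * f (insert y (J - {z})))"
      unfolding wedge_def using y finJ by (auto simp: insert_Diff_if intro!: sum.cong)
    then show "shuffle_sign y J * wedge f (insert y J) = f J + (\<Sum>z\<in>J. G y z)"
      by (simp add: G_def sum_distrib_left ring_distribs)
  qed
  have 2: "wedge (contract Y f) J = (\<Sum>z\<in>J. f J - (\<Sum>y\<in>Y - J. G y z))"
    unfolding wedge_def
  proof (rule sum.cong[OF refl])
    fix z assume z: "z \<in> J"
    have Y: "Y - (J - {z}) = insert z (Y - J)" using z assms by auto
    have *: "shuffle_sign z (J - {z}) * (shuffle_sign y (J - {z}) * f (insert y (J - {z}))) = - G y z" if "y \<in> Y - J" for y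
    proof -
      have "shuffle_sign y (insert z (J - {z})) * shuffle_sign z (J - {z}) = - (shuffle_sign z (insert y (J - {z})) * shuffle_sign y (J - {z}))"
        by (rule shuffle_sign_swap) (use finJ z that in auto)
      then have "shuffle_sign y J * shuffle_sign z (J - {z}) = - (shuffle_sign z (insert y (J - {z})) * shuffle_sign y (J - {z}))"
        using z by (simp add: insert_absorb)
      then have "shuffle_sign z (J - {z}) * shuffle_sign y (J - {z}) = - (shuffle_sign y J * shuffle_sign z (insert y (J - {z})))"
        using shuffle_sign_cases[of y J] shuffle_sign_cases[of z "J - {z}"] shuffle_sign_cases[of y "J - {z}"]
        by auto
      then show ?thesis unfolding G_def by (simp flip: mult.assoc)
    qed
    have "contract Y f (J - {z}) = shuffle_sign z (J - {z}) * f J + (\<Sum>y\<in>Y - J. shuffle_sign y (J - {z}) * f (insert y (J - {z})))"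
      unfolding contract_def Y using z assms by (subst sum.insert) (auto simp: insert_absorb)
    then have "shuffle_sign z (J - {z}) * contract Y f (J - {z}) = f J + (\<Sum>y\<in>Y - J. - G y z)"
      using * by (simp add: ring_distribs sum_distrib_left)
    then show "shuffle_sign z (J - {z}) * contract Y f (J - {z}) = f J - (\<Sum>y\<in>Y - J. G y z)"
      by (simp add: sum_negf)
  qed
  have "card Y = card (Y - J) + card J"
    using assms finJ by (simp add: card_Diff_subset card_mono)
  moreover have "(\<Sum>y\<in>Y - J. \<Sum>z\<in>J. G y z) = (\<Sum>z\<in>J. \<Sum>y\<in>Y - J. G y z)" by (rule sum.swap)
  ultimately show ?thesis unfolding 1 2 by (simp add: sum.distrib sum_subtractf algebra_simps)
qed

section \<open>An inequality for vectors indexed by a point and a set\<close>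

lemma ip_commute: "ip Y j f g = ip Y j g f"
  unfolding ip_def by (simp add: mult.commute)

lemma ip_add_left: "ip Y j (\<lambda>J. f J + g J) h = ip Y j f h + ip Y j g h"
  unfolding ip_def by (simp add: sum.distrib ring_distribs)

lemma ip_scale_left: "ip Y j (\<lambda>J. c * f J) h = c * ip Y j f h"
  unfolding ip_def by (simp add: sum_distrib_left mult.assoc)

lemma ip_add_right: "ip Y j h (\<lambda>J. f J + g J) = ip Y j h f + ip Y j h g"
  unfolding ip_def by (simp add: sum.distrib ring_distribs)

lemma ip_scale_right: "ip Y j h (\<lambda>J. c * f J) = c * ip Y j h f"
  unfolding ip_def by (simp add: sum_distrib_left algebra_simps)

lemma ip_diff_left: "ip Y j (\<lambda>J. f J - g J) h = ip Y j f h - ip Y j g h"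
  unfolding ip_def by (simp add: sum_subtractf ring_distribs)

lemma ip_diff_right: "ip Y j h (\<lambda>J. f J - g J) = ip Y j h f - ip Y j h g"
  unfolding ip_def by (simp add: sum_subtractf ring_distribs)

lemma ip_cong:
  assumes "\<And>J. J \<subseteq> Y \<Longrightarrow> f J = f' J" "\<And>J. J \<subseteq> Y \<Longrightarrow> g J = g' J"
  shows "ip Y j f g = ip Y j f' g'"
  unfolding ip_def by (rule sum.cong) (auto simp: layer_def assms)

lemmas ip_simps = ip_add_left ip_add_right ip_diff_left ip_diff_right ip_scale_left ip_scale_right

lemma contract_add: "contract Y (\<lambda>J. f J + g J) = (\<lambda>J. contract Y f J + contract Y g J)"
  unfolding contract_def by (simp add: sum.distrib ring_distribs)

lemma contract_scale: "contract Y (\<lambda>J. c * f J) = (\<lambda>J. c * contract Y f J)"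
  unfolding contract_def by (simp add: sum_distrib_left algebra_simps)

lemma ip_wedge_wedge:
  assumes "finite Y"
  shows "ip Y (Suc (Suc i)) (wedge f) (wedge g) =
    card Y * ip Y (Suc i) f g - ip Y i (contract Y f) (contract Y g)"
proof -
  have "ip Y (Suc (Suc i)) (wedge f) (wedge g) = ip Y (Suc i) f (contract Y (wedge g))"
    by (rule ip_wedge[OF assms])
  also have "\<dots> = ip Y (Suc i) f (\<lambda>J. real (card Y) * g J - wedge (contract Y g) J)"
    by (rule ip_cong) (simp_all add: contract_wedge[OF assms])
  also have "\<dots> = card Y * ip Y (Suc i) f g - ip Y (Suc i) (wedge (contract Y g)) f"
    by (simp add: ip_simps ip_commute[of _ _ _ "wedge (contract Y g)"])
  finally show ?thesis by (simp add: ip_wedge[OF assms] ip_commute[of _ _ "contract Y f"])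
qed

lemma ip_wedge_wedge_0:
  assumes "finite Y"
  shows "ip Y (Suc 0) (wedge f) (wedge g) = card Y * ip Y 0 f g"
proof -
  have "ip Y (Suc 0) (wedge f) (wedge g) = ip Y 0 f (contract Y (wedge g))"
    by (rule ip_wedge[OF assms])
  also have "\<dots> = ip Y 0 f (\<lambda>J. real (card Y) * g J)"
    using assms finite_subset[OF _ assms] unfolding ip_def
    by (intro sum.cong refl) (auto simp: layer_def contract_wedge wedge_def)
  finally show ?thesis by (simp add: ip_simps)
qed

text \<open>
  The left-hand side of the estimate is \<open>2 * \<langle>v, w\<rangle> - \<langle>w, w\<rangle>\<close> for the test vector
  \<open>w y J = f J + shuffle_sign y J * g (insert y J)\<close>.
\<close>

lemma pair_vector_bound:
  fixes v :: "'a::linorder \<Rightarrow> 'a set \<Rightarrow> real"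
  assumes Y: "finite Y"
  defines "a \<equiv> \<lambda>J. \<Sum>y\<in>Y - J. v y J"
  defines "b \<equiv> \<lambda>J. \<Sum>y\<in>J. shuffle_sign y (J - {y}) * v y (J - {y})"
  shows "2 * ip Y j a f + 2 * ip Y (Suc j) b g - (real (card Y) - real j) * ip Y j f f
    - 2 * ip Y j f (contract Y g) - real (Suc j) * ip Y (Suc j) g g
    \<le> (\<Sum>J\<in>layer Y j. \<Sum>y\<in>Y - J. (v y J)\<^sup>2)"
proof -
  let ?S = "\<lambda>F. \<Sum>J\<in>layer Y j. \<Sum>y\<in>Y - J. F y J :: real"
  have fin: "finite J" if "J \<subseteq> Y" for J using Y that finite_subset by blast
  have "0 \<le> ?S (\<lambda>y J. (v y J - f J - shuffle_sign y J * g (insert y J))\<^sup>2)"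
    by (intro sum_nonneg) auto
  also have "\<dots> = ?S (\<lambda>y J. (v y J)\<^sup>2 - 2 * (v y J * f J) - 2 * (shuffle_sign y J * v y J * g (insert y J))
      + f J * f J + 2 * (f J * (shuffle_sign y J * g (insert y J))) + g (insert y J) * g (insert y J))"
    by (intro sum.cong refl) (simp add: power2_eq_square algebra_simps)
  also have "\<dots> = ?S (\<lambda>y J. (v y J)\<^sup>2) - 2 * ?S (\<lambda>y J. v y J * f J)
     - 2 * ?S (\<lambda>y J. shuffle_sign y J * v y J * g (insert y J))
     + ?S (\<lambda>y J. f J * f J) + 2 * ?S (\<lambda>y J. f J * (shuffle_sign y J * g (insert y J)))
     + ?S (\<lambda>y J. g (insert y J) * g (insert y J))"
    by (simp add: sum.distrib sum_subtractf sum_distrib_left)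
  also have "?S (\<lambda>y J. v y J * f J) = ip Y j a f"
    unfolding ip_def a_def by (simp add: sum_distrib_right)
  also have "?S (\<lambda>y J. f J * (shuffle_sign y J * g (insert y J))) = ip Y j f (contract Y g)"
    unfolding ip_def contract_def by (simp add: sum_distrib_left)
  also have "?S (\<lambda>y J. f J * f J) = (real (card Y) - real j) * ip Y j f f"
    unfolding ip_def sum_distrib_left
    by (intro sum.cong refl) (auto simp: layer_def card_Diff_subset fin of_nat_diff card_mono Y)
  also have "?S (\<lambda>y J. shuffle_sign y J * v y J * g (insert y J)) = ip Y (Suc j) b g"
    unfolding ip_def b_def using sum_layer_Suc_insert[OF Y, of "\<lambda>y J J'. shuffle_sign y J * v y J * g J'" j]
    by (simp add: sum_distrib_right)
  also have "?S (\<lambda>y J. g (insert y J) * g (insert y J)) = real (Suc j) * ip Y (Suc j) g g"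
    unfolding ip_def using sum_layer_Suc_insert[OF Y, of "\<lambda>y J J'. g J' * g J'" j]
    by (simp add: sum_distrib_left layer_def)
  finally show ?thesis by (simp add: algebra_simps)
qed

text \<open>The choice of f as a multiple of \<open>a\<close> and g = 0 in
  \<open>pair_vector_bound\<close>. It is Cauchy-Schwarz over the \<open>card Y - j\<close> choices
  of y for each set of size j.\<close>

lemma pair_vector_bound_fst:
  fixes v :: "'a::linorder \<Rightarrow> 'a set \<Rightarrow> real"
  assumes Y: "finite Y" and j: "j < card Y"
  defines "a \<equiv> \<lambda>J. \<Sum>y\<in>Y - J. v y J"
  shows "ip Y j a a \<le> (real (card Y) - real j) * (\<Sum>J\<in>layer Y j. \<Sum>y\<in>Y - J. (v y J)\<^sup>2)"
proof -
  define c where "c = real (card Y) - real j"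
  have c: "c > 0" using j by (simp add: c_def)
  have [simp]: "contract Y (\<lambda>_. 0) = (\<lambda>_. 0)" "ip Y i (\<lambda>_. 0) h = 0" "ip Y i h (\<lambda>_. 0) = 0" for h i
    by (auto simp: contract_def ip_def)
  define e where "e = 1 / c"
  have e: "c * e = 1" using c by (simp add: e_def)
  have "2 * (e * ip Y j a a) - c * e * (e * ip Y j a a) \<le> (\<Sum>J\<in>layer Y j. \<Sum>y\<in>Y - J. (v y J)\<^sup>2)"
    using pair_vector_bound[OF Y, where v = v and j = j and f = "\<lambda>J. e * a J" and g = "\<lambda>_. 0", folded a_def c_def]
    by (simp add: ip_simps mult.assoc)
  then have "e * ip Y j a a \<le> (\<Sum>J\<in>layer Y j. \<Sum>y\<in>Y - J. (v y J)\<^sup>2)" by (simp add: e)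
  then show ?thesis using c unfolding c_def[symmetric] e_def by (simp add: field_simps)
qed

text \<open>The opposite choice, f = 0 and g a multiple of \<open>b\<close>: Cauchy-Schwarz over the
  \<open>Suc j\<close> ways to split an element off a set of size \<open>Suc j\<close>.\<close>

lemma pair_vector_bound_snd:
  fixes v :: "'a::linorder \<Rightarrow> 'a set \<Rightarrow> real"
  assumes Y: "finite Y"
  defines "b \<equiv> \<lambda>J. \<Sum>y\<in>J. shuffle_sign y (J - {y}) * v y (J - {y})"
  shows "ip Y (Suc j) b b \<le> real (Suc j) * (\<Sum>J\<in>layer Y j. \<Sum>y\<in>Y - J. (v y J)\<^sup>2)"
proof -
  define c where "c = real (Suc j)"
  have c: "c > 0" by (simp add: c_def)
  have [simp]: "ip Y i (\<lambda>_. 0) h = 0" "ip Y i h (\<lambda>_. 0) = 0" for h i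
    by (auto simp: ip_def)
  define e where "e = 1 / c"
  have e: "c * e = 1" using c by (simp add: e_def)
  have "2 * (e * ip Y (Suc j) b b) - c * e * (e * ip Y (Suc j) b b) \<le> (\<Sum>J\<in>layer Y j. \<Sum>y\<in>Y - J. (v y J)\<^sup>2)"
    using pair_vector_bound[OF Y, where v = v and j = j and g = "\<lambda>J. e * b J" and f = "\<lambda>_. 0", folded b_def c_def]
    by (simp add: ip_simps mult.assoc)
  then have "e * ip Y (Suc j) b b \<le> (\<Sum>J\<in>layer Y j. \<Sum>y\<in>Y - J. (v y J)\<^sup>2)" by (simp add: e)
  then show ?thesis using c unfolding c_def[symmetric] e_def by (simp add: field_simps)
qed

text \<open>
  Here \<open>f\<close> and \<open>g\<close> are the optimal choice in \<open>pair_vector_bound\<close>: they solve the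
  linear system \<open>a = (n - j) * f + contract Y g\<close>, \<open>b = wedge f + (j + 1) * g\<close>.
\<close>

lemma pair_vector_bound_mid:
  fixes v :: "'a::linorder \<Rightarrow> 'a set \<Rightarrow> real"
  assumes Y: "finite Y" and j: "j = Suc i" "Suc j < card Y"
  defines "a \<equiv> \<lambda>J. \<Sum>y\<in>Y - J. v y J"
  defines "b \<equiv> \<lambda>J. \<Sum>y\<in>J. shuffle_sign y (J - {y}) * v y (J - {y})"
  defines "n \<equiv> real (card Y)"
  defines "d \<equiv> real j * (n - 1 - real j)"
  shows "((real j + 1) * (ip Y j a a - ip Y i (contract Y a) (contract Y a) / n)
      - 2 * ip Y j a (contract Y b) + (n - real j) / n * ip Y j (contract Y b) (contract Y b)) / d
    + ip Y i (contract Y a) (contract Y a) / (n * (n - real j))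
    + (ip Y (Suc j) b b - ip Y j (contract Y b) (contract Y b) / n) / (real j + 1)
    \<le> (\<Sum>J\<in>layer Y j. \<Sum>y\<in>Y - J. (v y J)\<^sup>2)"
proof -
  let ?\<iota> = "contract Y"
  define k where "k = real j"
  define s1 where "s1 = ip Y j a a"
  define s2 where "s2 = ip Y i (?\<iota> a) (?\<iota> a)"
  define s3 where "s3 = ip Y (Suc j) b b"
  define s4 where "s4 = ip Y j (?\<iota> b) (?\<iota> b)"
  define s5 where "s5 = ip Y j a (?\<iota> b)"
  define p where "p = wedge (?\<iota> a)"
  define q where "q = ?\<iota> b"
  define r where "r = wedge q"
  define t where "t = wedge a"
  have kpos: "k > 0" "n - k > 0" "n > 0" "n - 1 - k > 0" using j by (auto simp: k_def n_def)
  then have nz: "k \<noteq> 0" "n - k \<noteq> 0" "n \<noteq> 0" "n - 1 - k \<noteq> 0" "k + 1 \<noteq> 0" by auto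
  have d: "d = k * (n - 1 - k)" by (simp add: d_def k_def)
  then have dnz: "d \<noteq> 0" using kpos by simp
  \<comment> \<open>f is sought in the span of \<open>a\<close>, \<open>p\<close>, \<open>q\<close>
    and g in the span of \<open>b\<close>, \<open>r\<close>, \<open>t\<close>. By the
    anticommutation relation the linear system stays within these spans, and comparing coefficients
    determines the five constants.\<close>
  define al where "al = (k + 1) / d"
  define be where "be = 1 / (n * (n - k)) - (k + 1) / (n * d)"
  define mu where "mu = - 1 / d"
  define al' where "al' = 1 / (k + 1)"
  define be' where "be' = (n - k) / (n * d) - 1 / (n * (k + 1))"
  define f where "f = (\<lambda>J. al * a J + be * p J + mu * q J)"
  define g where "g = (\<lambda>J. al' * b J + be' * r J + mu * t J)"
  have cc: "?\<iota> (?\<iota> h) J = 0" if "J \<subseteq> Y" for h J by (rule contract_contract[OF Y that])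
  have cr: "?\<iota> r J = n * q J" if "J \<subseteq> Y" for J
  proof -
    have "wedge (?\<iota> q) J = 0"
      unfolding wedge_def q_def by (intro sum.neutral ballI) (simp add: cc[OF subset_trans[OF Diff_subset that]])
    then show ?thesis by (simp add: r_def n_def contract_wedge[OF Y that])
  qed
  have ct: "?\<iota> t J = n * a J - p J" if "J \<subseteq> Y" for J
    by (simp add: t_def p_def n_def contract_wedge[OF Y that])
  have cg: "?\<iota> g J = mu * n * a J - mu * p J + (al' + be' * n) * q J" if "J \<subseteq> Y" for J
    unfolding g_def contract_add contract_scale q_def[symmetric]
    by (simp add: cr[OF that] ct[OF that]) (simp add: algebra_simps)
  have "(n - k) * al + mu * n = 1" "(n - k) * be - mu = 0" "(n - k) * mu + (al' + be' * n) = 0"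
    using nz dnz unfolding al_def be_def mu_def al'_def be'_def
    by (simp_all add: divide_simps) (simp_all add: d algebra_simps)
  then have eq1: "a J = (n - k) * f J + ?\<iota> g J" if "J \<subseteq> Y" for J
  proof -
    have "(n - k) * f J + ?\<iota> g J = ((n - k) * al + mu * n) * a J + ((n - k) * be - mu) * p J
       + ((n - k) * mu + (al' + be' * n)) * q J"
      unfolding cg[OF that] f_def by (simp add: algebra_simps)
    then show ?thesis using \<open>(n - k) * al + mu * n = 1\<close> \<open>(n - k) * be - mu = 0\<close>
      \<open>(n - k) * mu + (al' + be' * n) = 0\<close> by simp
  qed
  have "(k + 1) * al' = 1" "(k + 1) * be' + mu = 0" "(k + 1) * mu + al = 0"
    using nz dnz unfolding al_def be_def mu_def al'_def be'_def
    by (simp_all add: divide_simps) (simp_all add: d algebra_simps)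
  \<comment> \<open>The bracket is \<open>wedge f\<close> on subsets of \<open>Y\<close>: the term
    from \<open>p\<close> is absent because wedging twice with the same vector gives 0.\<close>
  then have eq2: "b J = (k + 1) * g J + (al * t J + mu * r J)" for J
  proof -
    have "(k + 1) * g J + (al * t J + mu * r J) = ((k + 1) * al') * b J + ((k + 1) * be' + mu) * r J
       + ((k + 1) * mu + al) * t J"
      unfolding g_def by (simp add: algebra_simps)
    then show ?thesis using \<open>(k + 1) * al' = 1\<close> \<open>(k + 1) * be' + mu = 0\<close> \<open>(k + 1) * mu + al = 0\<close> by simp
  qed
  \<comment> \<open>Adjointness turns the wedge in \<open>p\<close> into a second contraction of g,
    which vanishes.\<close>
  have pcg: "ip Y j p (?\<iota> g) = 0"
    unfolding p_def j ip_wedge[OF Y] unfolding ip_def by (auto intro!: sum.neutral simp: layer_def cc)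
  have fcg: "ip Y j f (?\<iota> g) = ip Y (Suc j) (\<lambda>J. al * t J + mu * r J) g"
    unfolding f_def by (simp add: ip_simps pcg t_def r_def ip_wedge[OF Y])
  \<comment> \<open>For the solution of the system, the test vector w is the orthogonal projection
    of v. Hence the bound \<open>2 * <v, w> - <w, w>\<close> collapses to \<open><v, w>\<close>,
    which is \<open>ip Y j a f + ip Y (Suc j) b g\<close>.\<close>
  have "ip Y j a f = (n - k) * ip Y j f f + ip Y j f (?\<iota> g)"
    by (subst ip_cong[of Y a "\<lambda>J. (n - k) * f J + ?\<iota> g J" f f j, OF eq1 refl])
      (simp_all add: ip_simps ip_commute[of Y j "?\<iota> g"])
  moreover have "ip Y (Suc j) b g = (k + 1) * ip Y (Suc j) g g + ip Y j f (?\<iota> g)"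
    by (subst ip_cong[of Y b "\<lambda>J. (k + 1) * g J + (al * t J + mu * r J)" g g "Suc j", OF eq2 refl])
      (simp_all add: ip_simps fcg)
  ultimately have "ip Y j a f + ip Y (Suc j) b g \<le> (\<Sum>J\<in>layer Y j. \<Sum>y\<in>Y - J. (v y J)\<^sup>2)"
    using pair_vector_bound[OF Y, where v = v and j = j and f = f and g = g, folded a_def b_def]
    by (simp add: n_def k_def algebra_simps)
  moreover have "ip Y j a f = al * s1 + be * s2 + mu * s5"
  proof -
    have "ip Y j a p = s2"
      by (simp add: p_def j ip_wedge[OF Y] s2_def ip_commute[of Y "Suc i" a])
    then show ?thesis by (simp add: f_def ip_simps s1_def s5_def q_def)
  qed
  moreover have "ip Y (Suc j) b g = al' * s3 + be' * s4 + mu * s5"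
  proof -
    have "ip Y (Suc j) b r = s4" "ip Y (Suc j) b t = s5"
      by (simp_all add: r_def t_def q_def ip_wedge[OF Y] s4_def s5_def ip_commute[of Y "Suc j" b])
    then show ?thesis by (simp add: g_def ip_simps s3_def)
  qed
  moreover have "(al * s1 + be * s2 + mu * s5) + (al' * s3 + be' * s4 + mu * s5)
    = ((k + 1) * (s1 - s2 / n) - 2 * s5 + (n - k) / n * s4) / d + s2 / (n * (n - k)) + (s3 - s4 / n) / (k + 1)"
    unfolding al_def be_def mu_def al'_def be'_def using nz dnz
    by (simp add: add_divide_distrib diff_divide_distrib ring_distribs)
  ultimately show ?thesis
    unfolding s1_def s2_def s3_def s4_def s5_def k_def by linarith
qed

section \<open>Levels of a family of bijections\<close>

text \<open>The matrix entry from the basis vector of \<open>I\<close> to that of \<open>J\<close>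
  of the sum of all members of \<open>S\<close>, acting on the exterior algebra.\<close>

definition amplitude :: "('a::linorder \<Rightarrow> 'b::linorder) set \<Rightarrow> 'a set \<Rightarrow> 'b set \<Rightarrow> real" where
  "amplitude S I J = (\<Sum>p\<in>S. of_bool (p ` I = J) * inversion_sign p I)"

definition level :: "'a::linorder set \<Rightarrow> 'b::linorder set \<Rightarrow> ('a \<Rightarrow> 'b) set \<Rightarrow> nat \<Rightarrow> real" where
  "level X Y S j = (\<Sum>I\<in>layer X j. ip Y j (amplitude S I) (amplitude S I))"

text \<open>
  In the notation of the introduction, \<open>level X Y S j\<close> is \<open>h\<^sub>j + h\<^sub>j\<^sub>-\<^sub>1\<close> and \<open>contracted_level X Y S i\<close>
  is \<open>n * h\<^sub>i\<close>.
\<close>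

definition contracted_level :: "'a::linorder set \<Rightarrow> 'b::linorder set \<Rightarrow> ('a \<Rightarrow> 'b) set \<Rightarrow> nat \<Rightarrow> real" where
  "contracted_level X Y S i =
    (\<Sum>I\<in>layer X (Suc i). ip Y i (contract Y (amplitude S I)) (contract Y (amplitude S I)))"

definition total_level :: "'a::linorder set \<Rightarrow> 'b::linorder set \<Rightarrow> ('a \<Rightarrow> 'b) set \<Rightarrow> real" where
  "total_level X Y S = (\<Sum>j\<le>card X. level X Y S j)"

locale bij_family =
  fixes X :: "'a::linorder set" and Y :: "'b::linorder set" and S :: "('a \<Rightarrow> 'b) set"
  assumes finite_X: "finite X" and finite_Y: "finite Y" and finite_S: "finite S"
    and card_Y: "card Y = card X"
    and bij: "p \<in> S \<Longrightarrow> bij_betw p X Y"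
begin

text \<open>For x outside \<open>I\<close> and y outside \<open>J\<close>, this is a matrix entry in
  the representation induced from the exterior algebra on one point fewer; the marked points x and y
  are the removed ones.\<close>

definition pair_amplitude :: "'a \<Rightarrow> 'a set \<Rightarrow> 'b \<Rightarrow> 'b set \<Rightarrow> real" where
  "pair_amplitude x I y J = (\<Sum>p\<in>S. of_bool (p x = y \<and> p ` I = J) * inversion_sign p I)"

abbreviation "A \<equiv> amplitude S"
abbreviation "D \<equiv> pair_amplitude"
abbreviation "lev \<equiv> level X Y S"
abbreviation "m \<equiv> contracted_level X Y S"
abbreviation "tot \<equiv> total_level X Y S"
abbreviation "n \<equiv> real (card X)"

lemma maps: "p \<in> S \<Longrightarrow> x \<in> X \<Longrightarrow> p x \<in> Y"
  using bij by (auto simp: bij_betw_def)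

lemma inj: "p \<in> S \<Longrightarrow> inj_on p X"
  using bij by (auto simp: bij_betw_def)

lemma pair_amplitude_filter: "D x I y J = amplitude {p \<in> S. p x = y} I J"
proof -
  have "D x I y J = (\<Sum>p\<in>S. if p x = y then of_bool (p ` I = J) * inversion_sign p I else 0)"
    unfolding pair_amplitude_def by (rule sum.cong) auto
  also have "\<dots> = amplitude {p \<in> S. p x = y} I J"
    unfolding amplitude_def by (rule sum.inter_filter[OF finite_S, symmetric])
  finally show ?thesis .
qed

text \<open>Injectivity forces \<open>p x\<close> outside \<open>J\<close> once \<open>I\<close> is
  mapped onto \<open>J\<close>, so exactly one y contributes for each such p. This and the next
  three lemmas say that forgetting or adjoining the marked point commutes with the action of
  \<open>S\<close>.\<close>

lemma sum_pair_amplitude_right: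
  assumes "I \<subseteq> X" "x \<in> X - I"
  shows "(\<Sum>y\<in>Y - J. D x I y J) = A I J"
proof -
  have "(\<Sum>y\<in>Y - J. of_bool (p x = y \<and> p ` I = J) * inversion_sign p I) = of_bool (p ` I = J) * inversion_sign p I"
    if p: "p \<in> S" for p
  proof (cases "p ` I = J")
    case True
    then have "p x \<in> Y - J"
      using assms maps[OF p] inj[OF p] by (auto simp: inj_on_def)
    then have "(\<Sum>y\<in>Y - J. if p x = y then inversion_sign p I else 0) = inversion_sign p I"
      using finite_Y by simp
    then show ?thesis using True by (simp add: of_bool_def if_distrib[of "\<lambda>c. c * _"] cong: if_cong)
  qed simp
  then show ?thesis
    unfolding pair_amplitude_def amplitude_def by (subst sum.swap) simp
qed

lemma sum_pair_amplitude_left: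
  assumes "I \<subseteq> X" "y \<in> Y - J"
  shows "(\<Sum>x\<in>X - I. D x I y J) = A I J"
proof -
  have "(\<Sum>x\<in>X - I. of_bool (p x = y \<and> p ` I = J) * inversion_sign p I) = of_bool (p ` I = J) * inversion_sign p I"
    if p: "p \<in> S" for p
  proof (cases "p ` I = J")
    case True
    obtain z where z: "z \<in> X" "p z = y"
      using assms bij[OF p] by (auto simp: bij_betw_def)
    then have zI: "z \<in> X - I" using True assms by auto
    have "(p x = y) = (z = x)" if "x \<in> X - I" for x
      using z inj[OF p] that by (auto simp: inj_on_def)
    then have "(\<Sum>x\<in>X - I. of_bool (p x = y \<and> p ` I = J) * inversion_sign p I)
      = (\<Sum>x\<in>X - I. if z = x then inversion_sign p I else 0)"
      using True by (intro sum.cong) (auto simp: of_bool_def)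
    then show ?thesis using True zI finite_X by simp
  qed simp
  then show ?thesis
    unfolding pair_amplitude_def amplitude_def by (subst sum.swap) simp
qed

text \<open>Only y = \<open>p x\<close> contributes, and \<open>inversion_sign_insert\<close>
  converts the sign on \<open>I\<close> into the sign on \<open>insert x I\<close>.\<close>

lemma sum_pair_amplitude_wedge:
  assumes "I \<subseteq> X" "x \<in> X - I" "J \<subseteq> Y"
  shows "(\<Sum>y\<in>J. shuffle_sign y (J - {y}) * D x I y (J - {y})) = shuffle_sign x I * A (insert x I) J"
proof -
  have finJ: "finite J" and finI: "finite I" using assms finite_X finite_Y finite_subset by blast+
  have "(\<Sum>y\<in>J. shuffle_sign y (J - {y}) * (of_bool (p x = y \<and> p ` I = J - {y}) * inversion_sign p I))
    = shuffle_sign x I * (of_bool (p ` insert x I = J) * inversion_sign p (insert x I))" if p: "p \<in> S" for p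
  proof (cases "p ` insert x I = J")
    case True
    have inj': "inj_on p (insert x I)" using inj[OF p] by (rule inj_on_subset) (use assms in auto)
    have "p x \<notin> p ` I" using inj' assms by (simp add: inj_on_insert)
    then have J: "J - {p x} = p ` I" unfolding True[symmetric] by simp
    have "(\<Sum>y\<in>J. shuffle_sign y (J - {y}) * (of_bool (p x = y \<and> p ` I = J - {y}) * inversion_sign p I))
      = (\<Sum>y\<in>J. if p x = y then shuffle_sign (p x) (p ` I) * inversion_sign p I else 0)"
      by (intro sum.cong refl) (auto simp flip: J)
    also have "\<dots> = shuffle_sign (p x) (p ` I) * inversion_sign p I"
      using True finJ by auto
    finally show ?thesis
      using True inversion_sign_insert[OF finI _ inj'] assms by (simp add: mult_ac)
  next
    case False
    have "\<not> (p x = y \<and> p ` I = J - {y})" if "y \<in> J" for y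
      using False that by auto
    then show ?thesis using False by (auto intro!: sum.neutral)
  qed
  then show ?thesis
    unfolding pair_amplitude_def amplitude_def sum_distrib_left by (subst sum.swap) simp
qed

text \<open>The counterpart on the domain side: the only contributing x is the preimage of
  y.\<close>

lemma sum_pair_amplitude_contract:
  assumes "I \<subseteq> X" "y \<in> Y - J"
  shows "(\<Sum>x\<in>I. shuffle_sign x (I - {x}) * D x (I - {x}) y J) = shuffle_sign y J * A I (insert y J)"
proof -
  have finI: "finite I" using assms finite_X finite_subset by blast
  have "(\<Sum>x\<in>I. shuffle_sign x (I - {x}) * (of_bool (p x = y \<and> p ` (I - {x}) = J) * inversion_sign p (I - {x})))
    = shuffle_sign y J * (of_bool (p ` I = insert y J) * inversion_sign p I)" if p: "p \<in> S" for p
  proof (cases "p ` I = insert y J")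
    case True
    have injI: "inj_on p I" using inj[OF p] assms(1) by (rule inj_on_subset)
    have "y \<in> p ` I" using True by simp
    then obtain z where z: "z \<in> I" "p z = y" by auto
    have J: "p ` (I - {z}) = J"
    proof -
      have "p ` (I - {z}) = p ` I - {p z}" using inj_on_image_set_diff[OF injI, of I "{z}"] z by simp
      then show ?thesis using True z assms by simp
    qed
    have ins: "insert z (I - {z}) = I" using z by auto
    have "(\<Sum>x\<in>I. shuffle_sign x (I - {x}) * (of_bool (p x = y \<and> p ` (I - {x}) = J) * inversion_sign p (I - {x})))
      = (\<Sum>x\<in>I. if z = x then shuffle_sign z (I - {z}) * inversion_sign p (I - {z}) else 0)"
    proof (intro sum.cong refl)
      fix x assume x: "x \<in> I"
      then have "(p x = y) = (z = x)" using z inj_on_eq_iff[OF injI, of z x] by auto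
      then show "shuffle_sign x (I - {x}) * (of_bool (p x = y \<and> p ` (I - {x}) = J) * inversion_sign p (I - {x}))
        = (if z = x then shuffle_sign z (I - {z}) * inversion_sign p (I - {z}) else 0)"
        using J by (cases "z = x") simp_all
    qed
    also have "\<dots> = shuffle_sign z (I - {z}) * inversion_sign p (I - {z})"
      using finI z by simp
    also have "inversion_sign p (I - {z}) = shuffle_sign z (I - {z}) * shuffle_sign y J * inversion_sign p I"
      using inversion_sign_insert[of "I - {z}" z p] finI injI z(2) unfolding ins J by (simp add: mult_ac)
    finally show ?thesis using True by (simp add: mult_ac)
  next
    case False
    have "\<not> (p x = y \<and> p ` (I - {x}) = J)" if "x \<in> I" for x
      using False that by auto
    then show ?thesis using False by (auto intro!: sum.neutral)
  qed
  then show ?thesis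
    unfolding pair_amplitude_def amplitude_def sum_distrib_left by (subst sum.swap) simp
qed

text \<open>Bijections carry the all-ones vector of the domain to that of the target, so the action
  of \<open>S\<close> commutes with wedging by it. The signed sum over x is the wedge on the domain
  side.\<close>

lemma wedge_amplitude:
  assumes "I \<subseteq> X" "J \<subseteq> Y"
  shows "wedge (A I) J = (\<Sum>x\<in>X - I. shuffle_sign x I * A (insert x I) J)"
proof -
  have "(\<Sum>x\<in>X - I. shuffle_sign x I * A (insert x I) J)
    = (\<Sum>x\<in>X - I. \<Sum>y\<in>J. shuffle_sign y (J - {y}) * D x I y (J - {y}))"
    by (intro sum.cong refl) (simp add: sum_pair_amplitude_wedge assms)
  also have "\<dots> = (\<Sum>y\<in>J. shuffle_sign y (J - {y}) * (\<Sum>x\<in>X - I. D x I y (J - {y})))"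
    by (subst sum.swap) (simp add: sum_distrib_left)
  also have "\<dots> = wedge (A I) J"
    unfolding wedge_def using assms by (intro sum.cong refl) (auto simp: sum_pair_amplitude_left)
  finally show ?thesis by simp
qed

text \<open>The same equivariance for the adjoint operation.\<close>

lemma contract_amplitude:
  assumes "I \<subseteq> X" "J \<subseteq> Y"
  shows "contract Y (A I) J = (\<Sum>x\<in>I. shuffle_sign x (I - {x}) * A (I - {x}) J)"
proof -
  have "contract Y (A I) J = (\<Sum>y\<in>Y - J. \<Sum>x\<in>I. shuffle_sign x (I - {x}) * D x (I - {x}) y J)"
    unfolding contract_def by (intro sum.cong refl) (simp add: sum_pair_amplitude_contract assms)
  also have "\<dots> = (\<Sum>x\<in>I. shuffle_sign x (I - {x}) * (\<Sum>y\<in>Y - J. D x (I - {x}) y J))"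
    by (subst sum.swap) (simp add: sum_distrib_left)
  also have "\<dots> = (\<Sum>x\<in>I. shuffle_sign x (I - {x}) * A (I - {x}) J)"
    using assms by (intro sum.cong refl, subst sum_pair_amplitude_right) auto
  finally show ?thesis .
qed

section \<open>Recurrences between levels and contracted levels\<close>

lemma ip_sum_left: "ip Z j (\<lambda>J. \<Sum>x\<in>T. c x * F x J) h = (\<Sum>x\<in>T. c x * ip Z j (F x) h)"
  unfolding ip_def by (simp add: sum_distrib_left sum_distrib_right mult.assoc) (rule sum.swap)

text \<open>Reindexing by the larger set makes the sum over x the right-hand side of
  \<open>contract_amplitude\<close>, so the mixed inner products add up to squared norms of
  contractions.\<close>

lemma cross_level:
  "(\<Sum>I\<in>layer X i. \<Sum>x\<in>X - I. shuffle_sign x I * ip Y i (A I) (contract Y (A (insert x I)))) = m i"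
proof -
  have "(\<Sum>I\<in>layer X i. \<Sum>x\<in>X - I. shuffle_sign x I * ip Y i (A I) (contract Y (A (insert x I))))
    = (\<Sum>I\<in>layer X (Suc i). \<Sum>x\<in>I. shuffle_sign x (I - {x}) * ip Y i (A (I - {x})) (contract Y (A I)))"
    by (rule sum_layer_Suc_insert[OF finite_X, symmetric, of "\<lambda>x I I'. shuffle_sign x I * ip Y i (A I) (contract Y (A I'))"])
  also have "\<dots> = m i"
    unfolding contracted_level_def
  proof (intro sum.cong refl)
    fix I assume "I \<in> layer X (Suc i)"
    then have I: "I \<subseteq> X" by (simp add: layer_def)
    have "ip Y i (contract Y (A I)) (contract Y (A I))
      = ip Y i (\<lambda>J. \<Sum>x\<in>I. shuffle_sign x (I - {x}) * A (I - {x}) J) (contract Y (A I))"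
      by (rule ip_cong) (auto simp: contract_amplitude I)
    then show "(\<Sum>x\<in>I. shuffle_sign x (I - {x}) * ip Y i (A (I - {x})) (contract Y (A I)))
        = ip Y i (contract Y (A I)) (contract Y (A I))"
      by (simp add: ip_sum_left)
  qed
  finally show ?thesis .
qed

text \<open>Expanding one factor by \<open>wedge_amplitude\<close> and moving the other wedge across
  by adjointness gives the mixed sum of \<open>cross_level\<close>. Thus wedging from degree i and
  contracting from degree \<open>Suc i\<close> measure the same hook.\<close>

lemma wedge_level: "(\<Sum>I\<in>layer X i. ip Y (Suc i) (wedge (A I)) (wedge (A I))) = m i"
  unfolding cross_level[of i, symmetric]
proof (intro sum.cong refl)
  fix I assume "I \<in> layer X i"
  then have I: "I \<subseteq> X" by (simp add: layer_def)
  have "ip Y (Suc i) (wedge (A I)) (wedge (A I))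
    = ip Y (Suc i) (\<lambda>J. \<Sum>x\<in>X - I. shuffle_sign x I * A (insert x I) J) (wedge (A I))"
    by (rule ip_cong) (auto simp: wedge_amplitude I)
  also have "\<dots> = (\<Sum>x\<in>X - I. shuffle_sign x I * ip Y (Suc i) (wedge (A I)) (A (insert x I)))"
    by (simp add: ip_sum_left ip_commute)
  finally show "ip Y (Suc i) (wedge (A I)) (wedge (A I))
    = (\<Sum>x\<in>X - I. shuffle_sign x I * ip Y i (A I) (contract Y (A (insert x I))))"
    by (simp add: ip_wedge[OF finite_Y])
qed

lemma level_0: "n * lev 0 = m 0"
  unfolding wedge_level[symmetric] level_def
  by (simp add: ip_wedge_wedge_0[OF finite_Y] card_Y sum_distrib_left)

text \<open>An exterior power splits into two hooks, one seen by the wedge and one by the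
  contraction. The anticommutation relation, in the form \<open>ip_wedge_wedge\<close>, adds the two
  squared norms.\<close>

lemma level_Suc: "n * lev (Suc i) = m (Suc i) + m i"
proof -
  have "m (Suc i) = (\<Sum>I\<in>layer X (Suc i). n * ip Y (Suc i) (A I) (A I) - ip Y i (contract Y (A I)) (contract Y (A I)))"
    unfolding wedge_level[symmetric] by (simp add: ip_wedge_wedge[OF finite_Y] card_Y)
  then show ?thesis
    unfolding level_def contracted_level_def by (simp add: sum_distrib_left sum_subtractf)
qed

lemma contracted_level_nonneg: "0 \<le> m i"
  unfolding contracted_level_def ip_def by (intro sum_nonneg) auto

lemma contracted_level_top: "m (card X) = 0"
proof -
  have "I \<notin> layer X (Suc (card X))" for I
    using card_mono[OF finite_X, of I] by (auto simp: layer_def)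
  then have "layer X (Suc (card X)) = {}" by blast
  then show ?thesis by (simp add: contracted_level_def)
qed

text \<open>The squared Hilbert-Schmidt norm on the induced representation in degree j. It links n
  points to n - 1 points: \<open>sum_total_level_restrict\<close> expresses the sum over j by the
  subfamilies with one prescribed value.\<close>

definition pair_level :: "nat \<Rightarrow> real" where
  "pair_level j = (\<Sum>I\<in>layer X j. \<Sum>x\<in>X - I. \<Sum>J\<in>layer Y j. \<Sum>y\<in>Y - J. (D x I y J)\<^sup>2)"

lemma sum_complement_layer:
  "(\<Sum>I\<in>layer X j. \<Sum>x\<in>X - I. F I) = (n - real j) * (\<Sum>I\<in>layer X j. F I)"
proof -
  have "real (card (X - I)) = n - real j" if "I \<in> layer X j" for I
    using that finite_X finite_subset[OF _ finite_X, of I]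
    by (auto simp: layer_def card_Diff_subset of_nat_diff card_mono)
  then show ?thesis by (simp add: sum_distrib_left)
qed

lemma sum_insert_layer:
  "(\<Sum>I\<in>layer X j. \<Sum>x\<in>X - I. F (insert x I)) = real (Suc j) * (\<Sum>I\<in>layer X (Suc j). F I :: real)"
  unfolding sum_layer_Suc_insert[OF finite_X, symmetric, of "\<lambda>x I I'. F I'" j]
  by (simp add: sum_distrib_left layer_def)

text \<open>Projection of the induced representation to the exterior power of degree j. It serves j
  = n - 1, where the denominator in \<open>pair_vector_bound_mid\<close> vanishes;
  \<open>pair_level_ge_level_Suc\<close> serves j = 0 in the same way.\<close>

lemma pair_level_ge_level:
  assumes "j < card X"
  shows "lev j \<le> pair_level j"
proof -
  have "(n - real j) * lev j = (\<Sum>I\<in>layer X j. \<Sum>x\<in>X - I. ip Y j (A I) (A I))"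
    unfolding level_def sum_complement_layer ..
  also have "\<dots> = (\<Sum>I\<in>layer X j. \<Sum>x\<in>X - I. ip Y j (\<lambda>J. \<Sum>y\<in>Y - J. D x I y J) (\<lambda>J. \<Sum>y\<in>Y - J. D x I y J))"
    by (intro sum.cong refl) (auto simp: sum_pair_amplitude_right layer_def)
  also have "\<dots> \<le> (\<Sum>I\<in>layer X j. \<Sum>x\<in>X - I. (n - real j) * (\<Sum>J\<in>layer Y j. \<Sum>y\<in>Y - J. (D x I y J)\<^sup>2))"
    using assms pair_vector_bound_fst[OF finite_Y, of j] by (intro sum_mono) (simp add: card_Y)
  also have "\<dots> = (n - real j) * pair_level j"
    unfolding pair_level_def by (simp add: sum_distrib_left)
  finally show ?thesis using assms by simp
qed

lemma pair_level_ge_level_Suc: "lev (Suc j) \<le> pair_level j"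
proof -
  let ?b = "\<lambda>x I J. \<Sum>y\<in>J. shuffle_sign y (J - {y}) * D x I y (J - {y})"
  have "real (Suc j) * lev (Suc j) = (\<Sum>I\<in>layer X j. \<Sum>x\<in>X - I. ip Y (Suc j) (A (insert x I)) (A (insert x I)))"
    unfolding level_def by (rule sum_insert_layer[where F = "\<lambda>I. ip Y (Suc j) (A I) (A I)", symmetric])
  also have "\<dots> = (\<Sum>I\<in>layer X j. \<Sum>x\<in>X - I. ip Y (Suc j) (?b x I) (?b x I))"
  proof (intro sum.cong refl)
    fix I x assume *: "I \<in> layer X j" "x \<in> X - I"
    have "ip Y (Suc j) (?b x I) (?b x I)
      = ip Y (Suc j) (\<lambda>J. shuffle_sign x I * A (insert x I) J) (\<lambda>J. shuffle_sign x I * A (insert x I) J)"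
      by (rule ip_cong) (use * in \<open>auto simp: sum_pair_amplitude_wedge layer_def\<close>)
    then show "ip Y (Suc j) (A (insert x I)) (A (insert x I)) = ip Y (Suc j) (?b x I) (?b x I)"
      by (simp add: ip_simps)
  qed
  also have "\<dots> \<le> (\<Sum>I\<in>layer X j. \<Sum>x\<in>X - I. real (Suc j) * (\<Sum>J\<in>layer Y j. \<Sum>y\<in>Y - J. (D x I y J)\<^sup>2))"
    using pair_vector_bound_snd[OF finite_Y] by (intro sum_mono)
  also have "\<dots> = real (Suc j) * pair_level j"
    unfolding pair_level_def by (simp add: sum_distrib_left)
  finally show ?thesis by simp
qed

text \<open>The hook part of the induced representation is that of the exterior powers of degrees j
  and j + 1 together. The images of forgetting and adjoining the marked point are not orthogonal,
  hence the correction terms of \<open>pair_vector_bound_mid\<close>, which recombine after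
  summation.\<close>

lemma pair_level_ge_two_levels:
  assumes "0 < j" "Suc j < card X"
  shows "lev j + lev (Suc j) \<le> pair_level j"
proof -
  obtain i where j: "j = Suc i" using assms gr0_conv_Suc by blast
  define k where "k = real j"
  define d where "d = k * (n - 1 - k)"
  have nz: "k > 0" "n - k > 0" "n > 0" "n - 1 - k > 0" using assms by (auto simp: k_def)
  let ?b = "\<lambda>x I J. shuffle_sign x I * A (insert x I) J"
  let ?S = "\<lambda>F. \<Sum>I\<in>layer X j. \<Sum>x\<in>X - I. F x I :: real"
  define s1 where "s1 = (\<lambda>(x :: 'a) I. ip Y j (A I) (A I))"
  define s2 where "s2 = (\<lambda>(x :: 'a) I. ip Y i (contract Y (A I)) (contract Y (A I)))"
  define s3 where "s3 = (\<lambda>(x :: 'a) I. ip Y (Suc j) (A (insert x I)) (A (insert x I)))"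
  define s4 where "s4 = (\<lambda>(x :: 'a) I. ip Y j (contract Y (A (insert x I))) (contract Y (A (insert x I))))"
  define s5 where "s5 = (\<lambda>(x :: 'a) I. shuffle_sign x I * ip Y j (A I) (contract Y (A (insert x I))))"
  \<comment> \<open>\<open>pair_vector_bound_mid\<close> for the row of \<open>D\<close> at (x, I):
    its vector \<open>a\<close> is \<open>A I\<close>, and its vector \<open>b\<close> is
    \<open>A (insert x I)\<close> up to a sign that either cancels or is absorbed into
    \<open>s5\<close>.\<close>
  have bound: "((k + 1) * (s1 x I - s2 x I / n) - 2 * s5 x I + (n - k) / n * s4 x I) / d
    + s2 x I / (n * (n - k)) + (s3 x I - s4 x I / n) / (k + 1)
    \<le> (\<Sum>J\<in>layer Y j. \<Sum>y\<in>Y - J. (D x I y J)\<^sup>2)" if *: "I \<in> layer X j" "x \<in> X - I" for I x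
  proof -
    define a where "a = (\<lambda>J. \<Sum>y\<in>Y - J. D x I y J)"
    define b where "b = (\<lambda>J. \<Sum>y\<in>J. shuffle_sign y (J - {y}) * D x I y (J - {y}))"
    have I: "I \<subseteq> X" using * by (simp add: layer_def)
    have a: "a = A I" unfolding a_def using I * by (simp add: sum_pair_amplitude_right fun_eq_iff)
    have b: "b J = ?b x I J" if "J \<subseteq> Y" for J
      unfolding b_def using I * that by (simp add: sum_pair_amplitude_wedge)
    have cb: "contract Y b J = shuffle_sign x I * contract Y (A (insert x I)) J" if "J \<subseteq> Y" for J
    proof -
      have "contract Y b J = contract Y (?b x I) J"
        unfolding contract_def using that by (intro sum.cong refl) (simp add: b)
      then show ?thesis by (simp add: contract_scale)
    qed
    have "ip Y j a a = s1 x I" "ip Y i (contract Y a) (contract Y a) = s2 x I"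
      by (simp_all add: a s1_def s2_def)
    moreover have "ip Y (Suc j) b b = s3 x I"
    proof -
      have "ip Y (Suc j) b b = ip Y (Suc j) (?b x I) (?b x I)" by (rule ip_cong) (auto simp: b)
      then show ?thesis by (simp add: s3_def ip_simps)
    qed
    moreover have "ip Y j (contract Y b) (contract Y b) = s4 x I"
    proof -
      have "ip Y j (contract Y b) (contract Y b) = ip Y j (\<lambda>J. shuffle_sign x I * contract Y (A (insert x I)) J)
         (\<lambda>J. shuffle_sign x I * contract Y (A (insert x I)) J)" by (rule ip_cong) (auto simp: cb)
      then show ?thesis by (simp add: s4_def ip_simps)
    qed
    moreover have "ip Y j a (contract Y b) = s5 x I"
    proof -
      have "ip Y j a (contract Y b) = ip Y j a (\<lambda>J. shuffle_sign x I * contract Y (A (insert x I)) J)"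
        by (rule ip_cong) (auto simp: cb)
      then show ?thesis by (simp add: s5_def ip_simps a)
    qed
    ultimately show ?thesis
      using pair_vector_bound_mid[OF finite_Y j, where v = "\<lambda>y J. D x I y J", folded a_def b_def] assms
      by (simp add: card_Y d_def k_def)
  qed
  \<comment> \<open>Summation over (x, I) turns every inner product into a multiple of a level or a
    contracted level. Terms in I alone occur n - j times, terms in \<open>insert x I\<close> alone j
    + 1 times.\<close>
  have S1: "?S s1 = (n - k) * lev j" unfolding s1_def sum_complement_layer level_def k_def ..
  have S2: "?S s2 = (n - k) * m i" unfolding s2_def sum_complement_layer contracted_level_def k_def j ..
  have S3: "?S s3 = (k + 1) * lev (Suc j)"
    unfolding s3_def k_def using sum_insert_layer[where F = "\<lambda>I. ip Y (Suc j) (A I) (A I)" and j = j] by (simp add: level_def)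
  have S4: "?S s4 = (k + 1) * m j"
    unfolding s4_def k_def using sum_insert_layer[where F = "\<lambda>I. ip Y j (contract Y (A I)) (contract Y (A I))" and j = j]
    by (simp add: contracted_level_def)
  have S5: "?S s5 = m j" unfolding s5_def by (rule cross_level)
  have "?S (\<lambda>x I. ((k + 1) * (s1 x I - s2 x I / n) - 2 * s5 x I + (n - k) / n * s4 x I) / d
    + s2 x I / (n * (n - k)) + (s3 x I - s4 x I / n) / (k + 1)) \<le> pair_level j"
    unfolding pair_level_def by (intro sum_mono bound)
  also have "?S (\<lambda>x I. ((k + 1) * (s1 x I - s2 x I / n) - 2 * s5 x I + (n - k) / n * s4 x I) / d
    + s2 x I / (n * (n - k)) + (s3 x I - s4 x I / n) / (k + 1))
    = ((k + 1) * (?S s1 - ?S s2 / n) - 2 * ?S s5 + (n - k) / n * ?S s4) / d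
    + ?S s2 / (n * (n - k)) + (?S s3 - ?S s4 / n) / (k + 1)"
    by (simp add: sum.distrib sum_subtractf sum_divide_distrib[symmetric] sum_distrib_left[symmetric])
  also have "\<dots> = lev j + lev (Suc j)"
  proof -
    have l: "lev j = (m j + m i) / n" using level_Suc[of i] nz by (simp add: j field_simps)
    \<comment> \<open>This identity cancels the denominator d and leaves \<open>2 * m j / n\<close>,
      of which one half completes \<open>lev j\<close> and the other half cancels against the term
      from \<open>s4\<close>.\<close>
    have "(k + 1) * (n - k) - n = d" by (simp add: d_def algebra_simps)
    have "((k + 1) * (?S s1 - ?S s2 / n) - 2 * ?S s5 + (n - k) / n * ?S s4) = 2 * m j / n * ((k + 1) * (n - k) - n)"
      unfolding S1 S2 S4 S5 l using nz by (simp add: field_simps)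
    also have "\<dots> / d = 2 * m j / n"
      unfolding \<open>(k + 1) * (n - k) - n = d\<close> using nz by (simp add: d_def)
    finally have "((k + 1) * (?S s1 - ?S s2 / n) - 2 * ?S s5 + (n - k) / n * ?S s4) / d = 2 * m j / n" .
    moreover have "?S s2 / (n * (n - k)) = m i / n" unfolding S2 using nz by simp
    moreover have "(?S s3 - ?S s4 / n) / (k + 1) = lev (Suc j) - m j / n"
      unfolding S3 S4 using nz by (simp add: diff_divide_distrib)
    ultimately show ?thesis unfolding l by (simp add: add_divide_distrib)
  qed
  finally show ?thesis .
qed

text \<open>Each level strictly between 0 and n is counted twice, once from each of two consecutive
  indices j. The extreme indices j = 0 and j = n - 1 supply the missing second copies of levels 1
  and n - 1.\<close>

lemma sum_pair_level_ge:
  assumes "2 \<le> card X"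
  shows "2 * tot - 2 * lev 0 - 2 * lev (card X) \<le> (\<Sum>j<card X. pair_level j)"
proof -
  define N where "N = card X - 2"
  have N: "card X = Suc (Suc N)" using assms by (simp add: N_def)
  have t1: "tot = lev 0 + (\<Sum>j\<le>N. lev (Suc j)) + lev (card X)"
    unfolding total_level_def N by (simp only: sum.atMost_Suc[of _ "Suc N"] sum.atMost_Suc_shift[of _ N])
  have "(\<Sum>j<card X. pair_level j) = pair_level 0 + (\<Sum>j<N. pair_level (Suc j)) + pair_level (Suc N)"
    unfolding N by (simp only: sum.lessThan_Suc[of _ "Suc N"] sum.lessThan_Suc_shift[of _ N])
  moreover have "lev 1 \<le> pair_level 0" using pair_level_ge_level_Suc[of 0] by simp
  moreover have "lev (Suc N) \<le> pair_level (Suc N)" by (rule pair_level_ge_level) (simp add: N)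
  moreover have "(\<Sum>j<N. lev (Suc j) + lev (Suc (Suc j))) \<le> (\<Sum>j<N. pair_level (Suc j))"
    by (intro sum_mono pair_level_ge_two_levels) (auto simp: N)
  moreover have "(\<Sum>j\<le>N. lev (Suc j)) = (\<Sum>j<N. lev (Suc j)) + lev (Suc N)"
    by (simp flip: lessThan_Suc_atMost)
  moreover have "(\<Sum>j\<le>N. lev (Suc j)) = lev 1 + (\<Sum>j<N. lev (Suc (Suc j)))"
    by (simp only: lessThan_Suc_atMost[symmetric] sum.lessThan_Suc_shift[of _ N] One_nat_def)
  ultimately show ?thesis unfolding t1 by (simp add: sum.distrib)
qed

end

section \<open>Families without single cycle differences\<close>

lemma inversion_sign_insert2:
  assumes "finite I" "a \<notin> I" "b \<notin> I" "a \<noteq> b" "inj_on p (insert a (insert b I))"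
  shows "inversion_sign p (insert a (insert b I)) = inversion_sign p I * (shuffle_sign b I * shuffle_sign a (insert b I))
    * (shuffle_sign (p b) (p ` I) * shuffle_sign (p a) (insert (p b) (p ` I)))"
proof -
  have "inj_on p (insert b I)" using assms(5) by (rule inj_on_subset) auto
  then show ?thesis
    using inversion_sign_insert[of "insert b I" a p] inversion_sign_insert[of I b p] assms
    by (simp add: mult_ac)
qed

lemma inj_on_swap:
  assumes "a \<in> I" "b \<in> I" "inj_on p I"
  shows "inj_on (p(a := p b, b := p a)) I"
  using assms unfolding inj_on_def by auto

lemma image_swap:
  assumes "a \<in> I" "b \<in> I"
  shows "(p(a := p b, b := p a)) ` I = p ` I" (is "?q ` I = _")
proof
  show "?q ` I \<subseteq> p ` I" using assms by auto
  show "p ` I \<subseteq> ?q ` I"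
  proof (rule image_subsetI)
    fix x assume x: "x \<in> I"
    have "p x = ?q b \<or> p x = ?q a \<or> p x = ?q x" by auto
    then show "p x \<in> ?q ` I" using assms x by (elim disjE) (simp_all only: imageI)
  qed
qed

text \<open>Building \<open>I\<close> from the remaining set \<open>K\<close> by adding b and then
  a, p and the swapped map differ only in the order in which the two values enter the image;
  \<open>shuffle_sign_swap\<close> gives the sign.\<close>

lemma inversion_sign_swap:
  assumes fin: "finite I" and ab: "a \<in> I" "b \<in> I" "a \<noteq> b" and inj: "inj_on p I"
  shows "inversion_sign (p(a := p b, b := p a)) I = - inversion_sign p I"
proof -
  define K where "K = I - {a, b}"
  define q where "q = p(a := p b, b := p a)"
  have K: "finite K" "a \<notin> K" "b \<notin> K" and I: "I = insert a (insert b K)"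
    using fin ab by (auto simp: K_def)
  have qK: "q ` K = p ` K" and qp: "inversion_sign q K = inversion_sign p K"
    using K by (auto simp: q_def image_iff intro!: inversion_sign_cong)
  have pK: "p a \<notin> p ` K" "p b \<notin> p ` K" "p a \<noteq> p b"
    using inj K ab unfolding I by (auto simp: inj_on_insert)
  have "inj_on q (insert a (insert b K))"
    using inj_on_swap[OF ab(1,2) inj] unfolding I q_def .
  then have "inversion_sign q I = inversion_sign p K * (shuffle_sign b K * shuffle_sign a (insert b K))
    * (shuffle_sign (p a) (p ` K) * shuffle_sign (p b) (insert (p a) (p ` K)))"
    unfolding I using inversion_sign_insert2[of K a b q] K ab by (simp add: qK qp) (simp add: q_def)
  also have "shuffle_sign (p a) (p ` K) * shuffle_sign (p b) (insert (p a) (p ` K))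
    = - (shuffle_sign (p b) (p ` K) * shuffle_sign (p a) (insert (p b) (p ` K)))"
    using shuffle_sign_swap[of "p ` K" "p b" "p a"] K pK by (simp add: mult.commute)
  finally show ?thesis
    unfolding q_def[symmetric] using inversion_sign_insert2[of K a b p] K ab inj unfolding I by simp
qed

text \<open>For injective p and q, such a set is a single orbit of \<open>inv q o p\<close>,
  possibly a fixed point. Comparing images avoids inverses of functions that are bijective only on a
  subset.\<close>

definition agree_minimally :: "('a \<Rightarrow> 'b) \<Rightarrow> ('a \<Rightarrow> 'b) \<Rightarrow> 'a set \<Rightarrow> bool" where
  "agree_minimally p q C \<longleftrightarrow> C \<noteq> {} \<and> p ` C = q ` C \<and> (\<forall>D. D \<noteq> {} \<longrightarrow> D \<subset> C \<longrightarrow> p ` D \<noteq> q ` D)"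

lemma agree_minimally_exists:
  assumes "finite C" "C \<noteq> {}" "p ` C = q ` C"
  shows "\<exists>M. M \<subseteq> C \<and> agree_minimally p q M"
  using assms
proof (induction C rule: finite_psubset_induct)
  case (psubset C)
  show ?case
  proof (cases "agree_minimally p q C")
    case False
    then obtain D where D: "D \<noteq> {}" "D \<subset> C" "p ` D = q ` D"
      using psubset.prems by (auto simp: agree_minimally_def)
    then show ?thesis using psubset.IH[of D] by blast
  qed blast
qed

text \<open>The product of the two signs is the sign of the cycle \<open>inv q o p\<close> on C. The
  induction shortens the cycle by one point through a transposition of two values of q.\<close>

lemma inversion_sign_agree_minimally:
  assumes "finite C" "agree_minimally p q C" "inj_on p C" "inj_on q C"
  shows "inversion_sign p C * inversion_sign q C = - ((-1) ^ card C)"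
  using assms
proof (induction "card C" arbitrary: C q)
  case 0
  then show ?case by (auto simp: agree_minimally_def)
next
  case (Suc k)
  have min: "p ` D \<noteq> q ` D" if "D \<noteq> {}" "D \<subset> C" for D
    using Suc.prems that by (auto simp: agree_minimally_def)
  have im: "p ` C = q ` C" using Suc.prems by (simp add: agree_minimally_def)
  obtain a where a: "a \<in> C" using Suc.prems by (auto simp: agree_minimally_def)
  define K where "K = C - {a}"
  have K: "finite K" "a \<notin> K" "C = insert a K" "card K = k"
    using Suc.prems Suc.hyps a by (auto simp: K_def)
  show ?case
  proof (cases "K = {}")
    case True
    have "inversion_sign r {a} = 1" for r :: "'a \<Rightarrow> 'b"
      using inversion_sign_insert[of "{}" a r] by (simp add: shuffle_sign_def)
    then show ?thesis using K True by simp
  next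
    case False
    have "p a \<in> q ` C" using a im by blast
    then obtain b where b: "b \<in> C" "q b = p a" by auto
    have "b \<noteq> a"
    proof
      assume "b = a"
      then show False using min[of "{a}"] b False K by auto
    qed
    then have bK: "b \<in> K" using b by (simp add: K_def)
    \<comment> \<open>After the swap r agrees with p at a, so a splits off as a fixed point and the
      cycle continues on \<open>K\<close>.\<close>
    define r where "r = q(a := q b, b := q a)"
    have injr: "inj_on r C" unfolding r_def by (rule inj_on_swap[OF a b(1) Suc.prems(4)])
    have ra: "r a = p a" using \<open>b \<noteq> a\<close> b by (simp add: r_def)
    have rC: "r ` C = q ` C" unfolding r_def by (rule image_swap[OF a b(1)])
    have injs: "inj_on p K" "inj_on r K"
      using Suc.prems injr by (auto simp: K_def intro: inj_on_subset)
    have paK: "p a \<notin> p ` K" "r a \<notin> r ` K"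
      using Suc.prems(3) injr K(2) unfolding K(3) by (simp_all add: inj_on_insert)
    have "insert (p a) (p ` K) = insert (p a) (r ` K)"
      using im rC ra unfolding K(3) by simp
    then have rK: "p ` K = r ` K" using paK ra by (metis Diff_insert_absorb)
    have "agree_minimally p r K"
      unfolding agree_minimally_def
    proof (intro conjI allI impI)
      show "K \<noteq> {}" "p ` K = r ` K" by fact+
      fix D assume D: "D \<noteq> {}" "D \<subset> K"
      show "p ` D \<noteq> r ` D"
      proof
        assume eq: "p ` D = r ` D"
        have aD: "a \<notin> D" using D K by auto
        show False
        proof (cases "b \<in> D")
          \<comment> \<open>When b lies in \<open>D\<close>, adding a makes the set closed under the
            swap, so agreement of p with r becomes agreement of p with q on a proper subset of
            C.\<close>
          case True
          have "q ` insert a D = r ` insert a D"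
            unfolding r_def by (rule image_swap[symmetric]) (use True in auto)
          then have "q ` insert a D = p ` insert a D" using eq ra by simp
          moreover have "insert a D \<subset> C" using D K by auto
          ultimately show False using min[of "insert a D"] by auto
        next
          case False
          then have "r ` D = q ` D" using aD by (auto simp: r_def image_iff)
          then show False using eq min[of D] D K by auto
        qed
      qed
    qed
    then have "inversion_sign p K * inversion_sign r K = - ((-1) ^ card K)"
      using Suc.hyps(1)[of K r] K injs by simp
    moreover have "inversion_sign p C = inversion_sign p K * shuffle_sign a K * shuffle_sign (p a) (p ` K)"
      using inversion_sign_insert[of K a p] K Suc.prems(3) by simp
    moreover have "inversion_sign r C = inversion_sign r K * shuffle_sign a K * shuffle_sign (p a) (p ` K)"
      using inversion_sign_insert[of K a r] K injr ra rK by simp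
    ultimately have "inversion_sign p C * inversion_sign r C = - ((-1) ^ card K)"
      using shuffle_sign_cases[of a K] shuffle_sign_cases[of "p a" "p ` K"] by auto
    moreover have "inversion_sign r C = - inversion_sign q C"
      unfolding r_def using Suc.prems a b \<open>b \<noteq> a\<close> by (intro inversion_sign_swap) auto
    ultimately show ?thesis using K by simp
  qed
qed

section \<open>Toggling one orbit in a subset\<close>

lemma shuffle_sign_Un:
  assumes "finite I" "finite J" "I \<inter> J = {}"
  shows "shuffle_sign x (I \<union> J) = shuffle_sign x I * shuffle_sign x J"
proof -
  have "{a \<in> I \<union> J. x < a} = {a \<in> I. x < a} \<union> {a \<in> J. x < a}" by auto
  then show ?thesis using assms unfolding shuffle_sign_def
    by (simp add: card_Un_disjoint disjoint_iff flip: power_add)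
qed

text \<open>The inversions between \<open>I\<close> and C contribute a factor that depends on p only
  through the images of the two sets. Two maps with the same images therefore share this
  factor.\<close>

lemma inversion_sign_Un:
  assumes "finite I" "finite C" "I \<inter> C = {}" "inj_on p (I \<union> C)"
  shows "inversion_sign p (I \<union> C) = inversion_sign p I * inversion_sign p C
    * ((\<Prod>x\<in>I. shuffle_sign x C) * (\<Prod>y\<in>p ` I. shuffle_sign y (p ` C)))"
  using assms
proof (induction I rule: finite_induct)
  case empty
  then show ?case by simp
next
  case (insert x I)
  have inj: "inj_on p (I \<union> C)" "inj_on p (insert x I)"
    using insert.prems by (auto intro: inj_on_subset)
  have px: "p x \<notin> p ` I" using insert.hyps inj(2) by (simp add: inj_on_insert)
  have disj: "p ` I \<inter> p ` C = {}"
    using insert.prems by (auto simp: inj_on_def)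
  have "inversion_sign p (insert x I \<union> C) = inversion_sign p (I \<union> C) * shuffle_sign x (I \<union> C) * shuffle_sign (p x) (p ` (I \<union> C))"
    using inversion_sign_insert[of "I \<union> C" x p] insert.prems insert.hyps by simp
  moreover have "shuffle_sign x (I \<union> C) = shuffle_sign x I * shuffle_sign x C"
    by (rule shuffle_sign_Un) (use insert in auto)
  moreover have "shuffle_sign (p x) (p ` (I \<union> C)) = shuffle_sign (p x) (p ` I) * shuffle_sign (p x) (p ` C)"
    unfolding image_Un by (rule shuffle_sign_Un) (use insert disj in auto)
  moreover have "inversion_sign p (insert x I) = inversion_sign p I * shuffle_sign x I * shuffle_sign (p x) (p ` I)"
    by (rule inversion_sign_insert) (use insert inj in auto)
  moreover have "inversion_sign p (I \<union> C) = inversion_sign p I * inversion_sign p C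
    * ((\<Prod>x\<in>I. shuffle_sign x C) * (\<Prod>y\<in>p ` I. shuffle_sign y (p ` C)))"
    using insert inj by auto
  ultimately show ?case
    using insert.hyps px by (simp add: mult_ac)
qed

lemma prod_shuffle_sign_sq:
  "(\<Prod>x\<in>I. shuffle_sign x C) * (\<Prod>x\<in>I. shuffle_sign x C) = 1"
  by (simp flip: prod.distrib)

text \<open>The coefficient of \<open>t ^ card I\<close> in the expansion of det(1 - t P)
  contributed by \<open>I\<close>, where P is the permutation matrix of \<open>inv q o p\<close> for
  bijections p and q.\<close>

definition toggle_weight :: "('a::linorder \<Rightarrow> 'b::linorder) \<Rightarrow> ('a \<Rightarrow> 'b) \<Rightarrow> 'a set \<Rightarrow> real" where
  "toggle_weight p q I = of_bool (p ` I = q ` I) * (-1) ^ card I * (inversion_sign p I * inversion_sign q I)"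

text \<open>The cross factor of \<open>inversion_sign_Un\<close> appears squared, the orbit itself
  contributes \<open>- ((-1) ^ card M)\<close>, and the change of cardinality contributes
  \<open>(-1) ^ card M\<close>.\<close>

lemma toggle_weight_Un:
  assumes fin: "finite I" "finite M" and disj: "I \<inter> M = {}"
    and inj: "inj_on p (I \<union> M)" "inj_on q (I \<union> M)" and M: "agree_minimally p q M"
  shows "toggle_weight p q (I \<union> M) = - toggle_weight p q I"
proof -
  have pqM: "p ` M = q ` M" using M by (simp add: agree_minimally_def)
  have rem: "r ` I = r ` (I \<union> M) - r ` M" if "inj_on r (I \<union> M)" for r :: "'a \<Rightarrow> 'b"
    using inj_on_image_set_diff[OF that, of "I \<union> M" M] disj by (auto simp: Un_Diff Diff_triv)
  show ?thesis
  proof (cases "p ` I = q ` I")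
    case True
    have injM: "inj_on p M" "inj_on q M" using inj by (auto intro: inj_on_subset)
    define t where "t = (\<Prod>x\<in>I. shuffle_sign x M) * (\<Prod>y\<in>p ` I. shuffle_sign y (p ` M))"
    have "t * t = 1"
      unfolding t_def using prod_shuffle_sign_sq[where I = I and C = M] prod_shuffle_sign_sq[where I = "p ` I" and C = "p ` M"]
      by (simp add: algebra_simps)
    have "inversion_sign p (I \<union> M) = inversion_sign p I * inversion_sign p M * t"
      unfolding t_def using inversion_sign_Un[OF fin disj inj(1)] .
    moreover have "inversion_sign q (I \<union> M) = inversion_sign q I * inversion_sign q M * t"
      unfolding t_def True pqM using inversion_sign_Un[OF fin disj inj(2)] .
    ultimately have "inversion_sign p (I \<union> M) * inversion_sign q (I \<union> M)
      = (inversion_sign p I * inversion_sign q I) * (inversion_sign p M * inversion_sign q M) * (t * t)"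
      by (simp only: mult_ac)
    also have "\<dots> = - ((inversion_sign p I * inversion_sign q I) * (-1) ^ card M)"
      unfolding inversion_sign_agree_minimally[OF fin(2) M injM] \<open>t * t = 1\<close> by simp
    moreover have "p ` (I \<union> M) = q ` (I \<union> M)" using True pqM by (simp add: image_Un)
    ultimately show ?thesis
      using True fin disj by (simp add: toggle_weight_def card_Un_disjoint power_add)
  next
    case False
    then have "p ` (I \<union> M) \<noteq> q ` (I \<union> M)" using rem inj pqM by metis
    then show ?thesis using False by (simp add: toggle_weight_def)
  qed
qed

text \<open>
  Adding or removing \<open>M\<close> changes the sign of the weight, and the weight vanishes on sets that
  meet \<open>M\<close> in a proper nonempty subset.
\<close>

lemma sum_toggle_weight:
  assumes fin: "finite X" and MX: "M \<subseteq> X" and inj: "inj_on p X" "inj_on q X" and M: "agree_minimally p q M"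
  shows "(\<Sum>I\<in>Pow X. toggle_weight p q I * g I) = (\<Sum>I\<in>Pow (X - M). toggle_weight p q I * (g I - g (I \<union> M)))"
proof -
  let ?w = "toggle_weight p q"
  have finX: "finite I" if "I \<subseteq> X" for I using that fin finite_subset by blast
  have Mne: "M \<noteq> {}" and pqM: "p ` M = q ` M" using M by (auto simp: agree_minimally_def)
  have mixed: "?w I = 0" if I: "I \<in> Pow X" "I \<notin> Pow (X - M)" "I \<notin> (\<lambda>I. I \<union> M) ` Pow (X - M)" for I
  proof -
    have "\<not> M \<subseteq> I"
    proof
      assume "M \<subseteq> I"
      then have "I = (I - M) \<union> M" "I - M \<in> Pow (X - M)" using I by auto
      then show False using I(3) by blast
    qed
    then have "I \<inter> M \<subset> M" "I \<inter> M \<noteq> {}" using I by auto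
    then have "p ` (I \<inter> M) \<noteq> q ` (I \<inter> M)" using M by (auto simp: agree_minimally_def)
    moreover have "r ` (I \<inter> M) = r ` I \<inter> r ` M" if "inj_on r X" for r :: "'a \<Rightarrow> 'b"
      using inj_on_image_Int[OF that] I MX by auto
    ultimately have "p ` I \<noteq> q ` I" using inj pqM by metis
    then show ?thesis by (simp add: toggle_weight_def)
  qed
  have "(\<Sum>I\<in>Pow X. ?w I * g I) = (\<Sum>I\<in>Pow (X - M) \<union> (\<lambda>I. I \<union> M) ` Pow (X - M). ?w I * g I)"
    by (rule sum.mono_neutral_right) (use fin MX mixed in auto)
  also have "\<dots> = (\<Sum>I\<in>Pow (X - M). ?w I * g I) + (\<Sum>I\<in>(\<lambda>I. I \<union> M) ` Pow (X - M). ?w I * g I)"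
    by (rule sum.union_disjoint) (use fin Mne in auto)
  also have "(\<Sum>I\<in>(\<lambda>I. I \<union> M) ` Pow (X - M). ?w I * g I) = (\<Sum>I\<in>Pow (X - M). ?w (I \<union> M) * g (I \<union> M))"
    by (rule sum.reindex_cong[where l = "\<lambda>I. I \<union> M"]) (auto simp: inj_on_def)
  also have "\<dots> = (\<Sum>I\<in>Pow (X - M). - (?w I * g (I \<union> M)))"
  proof (intro sum.cong refl)
    fix I assume I: "I \<in> Pow (X - M)"
    have "?w (I \<union> M) = - ?w I"
      by (rule toggle_weight_Un[OF _ _ _ _ _ M]) (use I MX finX inj in \<open>auto intro: inj_on_subset\<close>)
    then show "?w (I \<union> M) * g (I \<union> M) = - (?w I * g (I \<union> M))" by simp
  qed
  finally show ?thesis by (simp add: sum_negf right_diff_distrib sum_subtractf)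
qed

text \<open>The sum is the derivative at t = 1 of det(1 - t P), a product of one factor
  \<open>1 - t ^ l\<close> per orbit of length l; two orbits give a double zero. Concretely,
  toggling an orbit \<open>M\<close> inside C replaces the weight \<open>card I\<close> by the
  constant \<open>- card M\<close>, and toggling an orbit \<open>M'\<close> outside C cancels the
  constant.\<close>

lemma sum_toggle_weight_card:
  assumes fin: "finite X" and inj: "inj_on p X" "inj_on q X" and pq: "p ` X = q ` X"
    and C: "C \<noteq> {}" "C \<subset> X" "p ` C = q ` C"
  shows "(\<Sum>I\<in>Pow X. toggle_weight p q I * real (card I)) = 0"
proof -
  let ?w = "toggle_weight p q"
  have "finite C" using C fin finite_subset by blast
  then obtain M where M: "M \<subseteq> C" "agree_minimally p q M"
    using agree_minimally_exists[of C p q] C by blast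
  have "p ` (X - C) = q ` (X - C)"
    using inj_on_image_set_diff[OF inj(1), of X C] inj_on_image_set_diff[OF inj(2), of X C] C pq by auto
  moreover have "X - C \<noteq> {}" using C by auto
  ultimately obtain M' where M': "M' \<subseteq> X - C" "agree_minimally p q M'"
    using agree_minimally_exists[of "X - C" p q] fin by blast
  have finM: "finite M" using M C fin by (meson finite_subset psubsetE)
  have "(\<Sum>I\<in>Pow X. ?w I * real (card I)) = (\<Sum>I\<in>Pow (X - M). ?w I * (real (card I) - real (card (I \<union> M))))"
    by (rule sum_toggle_weight) (use fin inj M C in auto)
  also have "\<dots> = (\<Sum>I\<in>Pow (X - M). ?w I * (- real (card M)))"
  proof (intro sum.cong refl)
    fix I assume "I \<in> Pow (X - M)"
    then have "I \<inter> M = {}" "finite I" using fin finite_subset by auto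
    then show "?w I * (real (card I) - real (card (I \<union> M))) = ?w I * (- real (card M))"
      using finM by (simp add: card_Un_disjoint)
  qed
  also have "\<dots> = (\<Sum>I\<in>Pow (X - M - M'). ?w I * (- real (card M) - - real (card M)))"
    by (rule sum_toggle_weight[where g = "\<lambda>_. - real (card M)"])
      (use fin inj M M' in \<open>auto intro: inj_on_subset\<close>)
  finally show ?thesis by simp
qed

lemma sum_layers:
  assumes "finite X"
  shows "(\<Sum>k\<le>card X. \<Sum>I\<in>layer X k. f I) = (\<Sum>I\<in>Pow X. f I)"
proof -
  have "{I \<in> Pow X. card I = k} = layer X k" for k by (auto simp: layer_def)
  then show ?thesis
    using sum.group[of "Pow X" "{..card X}" card f] assms by (auto simp: card_mono image_subset_iff)
qed

section \<open>Alternating sums of levels and the lower bound for odd n\<close>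

context bij_family
begin

lemma level_pairs:
  "lev k = (\<Sum>I\<in>layer X k. \<Sum>p\<in>S. \<Sum>q\<in>S. of_bool (p ` I = q ` I) * (inversion_sign p I * inversion_sign q I))"
  unfolding level_def
proof (intro sum.cong refl)
  fix I assume I: "I \<in> layer X k"
  let ?e = "\<lambda>p. inversion_sign p I"
  have pI: "p ` I \<in> layer Y k" if "p \<in> S" for p
    using I bij[OF that] maps[OF that] by (auto simp: layer_def card_image bij_betw_def inj_on_subset)
  have "ip Y k (A I) (A I)
    = (\<Sum>J\<in>layer Y k. \<Sum>p\<in>S. \<Sum>q\<in>S. of_bool (p ` I = J) * of_bool (q ` I = J) * (?e p * ?e q))"
    unfolding ip_def amplitude_def by (simp add: sum_product mult_ac)
  also have "\<dots> = (\<Sum>p\<in>S. \<Sum>J\<in>layer Y k. \<Sum>q\<in>S. of_bool (p ` I = J) * of_bool (q ` I = J) * (?e p * ?e q))"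
    by (rule sum.swap)
  also have "\<dots> = (\<Sum>p\<in>S. \<Sum>q\<in>S. \<Sum>J\<in>layer Y k. of_bool (p ` I = J) * of_bool (q ` I = J) * (?e p * ?e q))"
    by (rule sum.cong[OF refl], rule sum.swap)
  also have "\<dots> = (\<Sum>p\<in>S. \<Sum>q\<in>S. of_bool (p ` I = q ` I) * (?e p * ?e q))"
  proof (intro sum.cong refl)
    fix p q assume "p \<in> S" "q \<in> S"
    have "(\<Sum>J\<in>layer Y k. of_bool (p ` I = J) * of_bool (q ` I = J) * (?e p * ?e q))
      = (\<Sum>J\<in>layer Y k. if p ` I = J then of_bool (p ` I = q ` I) * (?e p * ?e q) else 0)"
      by (intro sum.cong) auto
    also have "\<dots> = of_bool (p ` I = q ` I) * (?e p * ?e q)"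
      using pI[OF \<open>p \<in> S\<close>] finite_Y by simp
    finally show "(\<Sum>J\<in>layer Y k. of_bool (p ` I = J) * of_bool (q ` I = J) * (?e p * ?e q))
      = of_bool (p ` I = q ` I) * (?e p * ?e q)" .
  qed
  finally show "ip Y k (A I) (A I) = (\<Sum>p\<in>S. \<Sum>q\<in>S. of_bool (p ` I = q ` I) * (?e p * ?e q))" .
qed

text \<open>The sums are exchanged so that \<open>sum_toggle_weight_card\<close> applies to each
  pair p, q. The weight k is essential for information: the plain alternating sum of the levels
  telescopes to 0 by \<open>level_0\<close> and \<open>level_Suc\<close>.\<close>

lemma alternating_level_sum:
  assumes split: "\<And>p q. p \<in> S \<Longrightarrow> q \<in> S \<Longrightarrow> \<exists>C. C \<noteq> {} \<and> C \<subset> X \<and> p ` C = q ` C"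
  shows "(\<Sum>k\<le>card X. (-1) ^ k * real k * lev k) = 0"
proof -
  have "(\<Sum>k\<le>card X. (-1) ^ k * real k * lev k)
    = (\<Sum>k\<le>card X. \<Sum>I\<in>layer X k. \<Sum>p\<in>S. \<Sum>q\<in>S. toggle_weight p q I * real (card I))"
    unfolding level_pairs sum_distrib_left
    by (intro sum.cong refl) (auto simp: layer_def toggle_weight_def mult_ac)
  also have "\<dots> = (\<Sum>I\<in>Pow X. \<Sum>p\<in>S. \<Sum>q\<in>S. toggle_weight p q I * real (card I))"
    by (rule sum_layers[OF finite_X])
  also have "\<dots> = (\<Sum>p\<in>S. \<Sum>I\<in>Pow X. \<Sum>q\<in>S. toggle_weight p q I * real (card I))"
    by (rule sum.swap)
  also have "\<dots> = (\<Sum>p\<in>S. \<Sum>q\<in>S. \<Sum>I\<in>Pow X. toggle_weight p q I * real (card I))"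
    by (rule sum.cong[OF refl], rule sum.swap)
  also have "\<dots> = 0"
  proof (rule sum.neutral, rule ballI, rule sum.neutral, rule ballI)
    fix p q assume pq: "p \<in> S" "q \<in> S"
    obtain C where "C \<noteq> {}" "C \<subset> X" "p ` C = q ` C" using split[OF pq] by blast
    moreover have "p ` X = q ` X" using bij[OF pq(1)] bij[OF pq(2)] by (simp add: bij_betw_def)
    ultimately show "(\<Sum>I\<in>Pow X. toggle_weight p q I * real (card I)) = 0"
      using sum_toggle_weight_card[OF finite_X inj[OF pq(1)] inj[OF pq(2)]] by blast
  qed
  finally show ?thesis .
qed

text \<open>Summation by parts: \<open>level_Suc\<close> writes each level as two neighbouring
  contracted levels, so the linear weight leaves each of them once, with alternating sign. The
  boundary term is \<open>m (card X)\<close>, which is 0.\<close>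

lemma alternating_contracted_sum:
  assumes "\<And>p q. p \<in> S \<Longrightarrow> q \<in> S \<Longrightarrow> \<exists>C. C \<noteq> {} \<and> C \<subset> X \<and> p ` C = q ` C"
  shows "(\<Sum>i<card X. (-1) ^ i * m i) = 0"
proof -
  have tele: "(\<Sum>i<N. (-1) ^ Suc i * real (Suc i) * (m (Suc i) + m i)) = (-1) ^ N * real N * m N - (\<Sum>i<N. (-1) ^ i * m i)" for N
    by (induction N) (simp_all add: algebra_simps)
  have "(\<Sum>k\<le>card X. (-1) ^ k * real k * lev k) = (\<Sum>i<card X. (-1) ^ Suc i * real (Suc i) * lev (Suc i))"
    unfolding lessThan_Suc_atMost[symmetric] by (simp add: sum.lessThan_Suc_shift del: sum.lessThan_Suc)
  then have "0 = n * (\<Sum>i<card X. (-1) ^ Suc i * real (Suc i) * lev (Suc i))"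
    using alternating_level_sum assms by simp
  also have "\<dots> = (\<Sum>i<card X. (-1) ^ Suc i * real (Suc i) * (n * lev (Suc i)))"
    by (simp add: sum_distrib_left mult_ac)
  finally show ?thesis
    unfolding level_Suc tele contracted_level_top by simp
qed

text \<open>n times the total is twice the sum of all \<open>m i\<close>. Adding twice the vanishing
  alternating sum doubles the terms of even index and removes the odd ones. For odd n both extreme
  indices 0 and n - 1 are even.\<close>

lemma total_level_lower:
  assumes "\<And>p q. p \<in> S \<Longrightarrow> q \<in> S \<Longrightarrow> \<exists>C. C \<noteq> {} \<and> C \<subset> X \<and> p ` C = q ` C"
    and odd: "odd (card X)" and card: "card X \<noteq> 1"
  shows "4 * (lev 0 + lev (card X)) \<le> tot"
proof -
  obtain N where N: "card X = Suc N" using odd by (cases "card X") auto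
  have N2: "N > 0" "even N" using odd card N by auto
  have "n * tot = n * lev 0 + (\<Sum>i<card X. n * lev (Suc i))"
    unfolding total_level_def lessThan_Suc_atMost[symmetric] sum.lessThan_Suc_shift
    by (simp add: ring_distribs sum_distrib_left)
  also have "\<dots> = m 0 + (\<Sum>i<card X. m (Suc i)) + (\<Sum>i<card X. m i)"
    unfolding level_Suc level_0 by (simp add: sum.distrib)
  also have "m 0 + (\<Sum>i<card X. m (Suc i)) = (\<Sum>i<Suc (card X). m i)"
    by (simp only: sum.lessThan_Suc_shift)
  also have "\<dots> = (\<Sum>i<card X. m i)" using contracted_level_top by simp
  also have "(\<Sum>i<card X. m i) + (\<Sum>i<card X. m i) = (\<Sum>i<card X. 2 * (1 + (-1) ^ i) * m i)"
    using alternating_contracted_sum assms(1) by (simp add: ring_distribs sum.distrib flip: sum_distrib_left) (simp add: mult.assoc flip: sum_distrib_left)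
  \<comment> \<open>All terms are nonnegative, and 0 and \<open>N\<close> are distinct because
    \<open>card X\<close> is not 1; each of the two keeps the factor 4.\<close>
  also have "\<dots> \<ge> (\<Sum>i\<in>{0, N}. 2 * (1 + (-1) ^ i) * m i)"
    by (rule sum_mono2) (auto simp: N minus_one_power_iff contracted_level_nonneg)
  also have "(\<Sum>i\<in>{0, N}. 2 * (1 + (-1) ^ i) * m i) = 4 * m 0 + 4 * m N"
    using N2 by simp
  also have "m 0 = n * lev 0" by (simp add: level_0)
  also have "m N = n * lev (card X)"
    using level_Suc[of N] contracted_level_top by (simp add: N)
  finally have "n * (4 * (lev 0 + lev (card X))) \<le> n * tot" by (simp add: algebra_simps)
  then show ?thesis using N by simp
qed

lemma level_zero: "lev 0 = (real (card S))\<^sup>2"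
proof -
  have "layer X 0 = {{}}" "layer Y 0 = {{}}"
    using finite_subset[OF _ finite_X] finite_subset[OF _ finite_Y] by (auto simp: layer_def)
  then show ?thesis by (simp add: level_def ip_def amplitude_def power2_eq_square)
qed

lemma level_top:
  assumes "\<And>p. p \<in> S \<Longrightarrow> inversion_sign p X = s" and "s * s = 1"
  shows "lev (card X) = (real (card S))\<^sup>2"
proof -
  have "layer X (card X) = {X}" "layer Y (card X) = {Y}"
    using card_subset_eq[OF finite_X] card_subset_eq[OF finite_Y] card_Y by (auto simp: layer_def)
  moreover have "A X Y = s * real (card S)"
    unfolding amplitude_def using assms(1) bij by (simp add: bij_betw_def)
  moreover have "s * real (card S) * (s * real (card S)) = s * s * (real (card S))\<^sup>2"
    by (simp only: power2_eq_square mult_ac)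
  ultimately show ?thesis using assms(2) by (simp add: level_def ip_def)
qed

section \<open>Prescribing the value at one point\<close>

lemma sum_layer_remove:
  assumes "finite Z"
  shows "(\<Sum>x\<in>Z. \<Sum>I\<in>layer (Z - {x}) j. f x I) = (\<Sum>I\<in>layer Z j. \<Sum>x\<in>Z - I. f x I)"
proof -
  have "(\<Sum>x\<in>Z. \<Sum>I\<in>layer (Z - {x}) j. f x I) = (\<Sum>(x, I)\<in>Sigma Z (\<lambda>x. layer (Z - {x}) j). f x I)"
    by (rule sum.Sigma) (use assms in auto)
  also have "\<dots> = (\<Sum>(I, x)\<in>Sigma (layer Z j) (\<lambda>I. Z - I). f x I)"
    by (rule sum.reindex_bij_witness[where i = "\<lambda>(I, x). (x, I)" and j = "\<lambda>(x, I). (I, x)"])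
      (auto simp: layer_def)
  also have "\<dots> = (\<Sum>I\<in>layer Z j. \<Sum>x\<in>Z - I. f x I)"
    by (rule sum.Sigma[symmetric]) (use assms in auto)
  finally show ?thesis .
qed

text \<open>By \<open>pair_amplitude_filter\<close> the amplitudes of the subfamily with
  \<open>p x = y\<close> are the values of \<open>D\<close>. What remains is to exchange the choice
  of the removed points with the choice of the sets avoiding them.\<close>

lemma sum_total_level_restrict:
  assumes "X \<noteq> {}"
  shows "(\<Sum>x\<in>X. \<Sum>y\<in>Y. total_level (X - {x}) (Y - {y}) {p \<in> S. p x = y}) = (\<Sum>j<card X. pair_level j)"
proof -
  have "0 < card X" using assms finite_X by (simp add: card_gt_0_iff)
  then have c: "{..card X - Suc 0} = {..<card X}" by auto
  have "(\<Sum>x\<in>X. \<Sum>y\<in>Y. total_level (X - {x}) (Y - {y}) {p \<in> S. p x = y})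
    = (\<Sum>x\<in>X. \<Sum>y\<in>Y. \<Sum>j<card X. \<Sum>I\<in>layer (X - {x}) j. \<Sum>J\<in>layer (Y - {y}) j. (D x I y J)\<^sup>2)"
    unfolding total_level_def level_def ip_def
    by (intro sum.cong) (auto simp: c pair_amplitude_filter power2_eq_square)
  also have "\<dots> = (\<Sum>x\<in>X. \<Sum>j<card X. \<Sum>y\<in>Y. \<Sum>I\<in>layer (X - {x}) j. \<Sum>J\<in>layer (Y - {y}) j. (D x I y J)\<^sup>2)"
    by (rule sum.cong[OF refl], rule sum.swap)
  also have "\<dots> = (\<Sum>x\<in>X. \<Sum>j<card X. \<Sum>I\<in>layer (X - {x}) j. \<Sum>y\<in>Y. \<Sum>J\<in>layer (Y - {y}) j. (D x I y J)\<^sup>2)"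
    by (rule sum.cong[OF refl], rule sum.cong[OF refl], rule sum.swap)
  also have "\<dots> = (\<Sum>x\<in>X. \<Sum>j<card X. \<Sum>I\<in>layer (X - {x}) j. \<Sum>J\<in>layer Y j. \<Sum>y\<in>Y - J. (D x I y J)\<^sup>2)"
    by (simp only: sum_layer_remove[OF finite_Y])
  also have "\<dots> = (\<Sum>j<card X. \<Sum>x\<in>X. \<Sum>I\<in>layer (X - {x}) j. \<Sum>J\<in>layer Y j. \<Sum>y\<in>Y - J. (D x I y J)\<^sup>2)"
    by (rule sum.swap)
  also have "\<dots> = (\<Sum>j<card X. pair_level j)"
    unfolding pair_level_def sum_layer_remove[OF finite_X] ..
  finally show ?thesis .
qed

end

section \<open>The size of a class\<close>

text \<open>Says that \<open>inv q o p\<close> is never one cycle of length at least 2 with all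
  other points fixed. Quantifying over every Z that contains the points of disagreement makes the
  condition pass to subfamilies with a prescribed value.\<close>

definition no_single_cycle :: "'a set \<Rightarrow> ('a \<Rightarrow> 'b) set \<Rightarrow> bool" where
  "no_single_cycle X S \<longleftrightarrow>
    (\<forall>p\<in>S. \<forall>q\<in>S. \<forall>Z\<subseteq>X. 2 \<le> card Z \<longrightarrow> p ` Z = q ` Z \<longrightarrow> (\<forall>x\<in>X - Z. p x = q x) \<longrightarrow>
      (\<exists>C. C \<noteq> {} \<and> C \<subset> Z \<and> p ` C = q ` C))"

lemma no_single_cycleD:
  assumes "no_single_cycle X S" "p \<in> S" "q \<in> S" "Z \<subseteq> X" "2 \<le> card Z" "p ` Z = q ` Z"
    and "\<And>x. x \<in> X - Z \<Longrightarrow> p x = q x"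
  shows "\<exists>C. C \<noteq> {} \<and> C \<subset> Z \<and> p ` C = q ` C"
  using assms unfolding no_single_cycle_def by (elim ballE[of _ _ p] ballE[of _ _ q] allE[of _ Z]) simp_all

text \<open>\<open>same_outside\<close> makes a member determined by its values on \<open>X\<close>,
  so that \<open>card S\<close> counts bijections between the finite sets. \<open>same_sign\<close>
  makes the top level as large as possible, namely the square of \<open>card S\<close>.\<close>

locale acyclic_family = bij_family +
  assumes same_outside: "p \<in> S \<Longrightarrow> q \<in> S \<Longrightarrow> x \<notin> X \<Longrightarrow> p x = q x"
    and same_sign: "p \<in> S \<Longrightarrow> q \<in> S \<Longrightarrow> inversion_sign p X = inversion_sign q X"
    and no_single_cycle: "no_single_cycle X S"
begin

text \<open>Prescribing \<open>p x = y\<close> changes all signs by one common factor, and the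
  members agree at x, so a set Z avoiding x can be tested in the larger family.\<close>

lemma restrict:
  assumes "x \<in> X" "y \<in> Y"
  shows "acyclic_family (X - {x}) (Y - {y}) {p \<in> S. p x = y}"
proof unfold_locales
  have im: "p ` (X - {x}) = Y - {y}" and inj': "inj_on p (X - {x})" if "p \<in> S" "p x = y" for p
    using bij[OF that(1)] assms that(2) inj_on_image_set_diff[of p X X "{x}"]
    by (auto simp: bij_betw_def inj_on_subset)
  show "finite (X - {x})" "finite (Y - {y})" "finite {p \<in> S. p x = y}"
    using finite_X finite_Y finite_S by auto
  show "card (Y - {y}) = card (X - {x})" using assms card_Y by simp
  show "bij_betw p (X - {x}) (Y - {y})" if "p \<in> {p \<in> S. p x = y}" for p
    using im inj' that by (simp add: bij_betw_def)
  show "p z = q z" if "p \<in> {p \<in> S. p x = y}" "q \<in> {p \<in> S. p x = y}" "z \<notin> X - {x}" for p q z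
    using that same_outside[of p q z] by auto
  have sgn: "inversion_sign p X = inversion_sign p (X - {x}) * shuffle_sign x (X - {x}) * shuffle_sign y (Y - {y})"
    if "p \<in> S" "p x = y" for p
    using inversion_sign_insert[of "X - {x}" x p] finite_X inj[OF that(1)] assms im[OF that] that(2)
    by (simp add: insert_absorb)
  show "inversion_sign p (X - {x}) = inversion_sign q (X - {x})"
    if "p \<in> {p \<in> S. p x = y}" "q \<in> {p \<in> S. p x = y}" for p q
    using sgn[of p] sgn[of q] that same_sign[of p q]
      shuffle_sign_cases[of x "X - {x}"] shuffle_sign_cases[of y "Y - {y}"] by auto
  show "no_single_cycle (X - {x}) {p \<in> S. p x = y}"
    unfolding no_single_cycle_def
  proof (intro ballI allI impI)
    fix p q Z
    assume pq: "p \<in> {p \<in> S. p x = y}" "q \<in> {p \<in> S. p x = y}" and Z: "Z \<subseteq> X - {x}" "2 \<le> card Z"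
      "p ` Z = q ` Z" and eq: "\<forall>z\<in>X - {x} - Z. p z = q z"
    have "p z = q z" if "z \<in> X - Z" for z using that pq eq by (cases "z = x") auto
    then show "\<exists>C. C \<noteq> {} \<and> C \<subset> Z \<and> p ` C = q ` C"
      using no_single_cycleD[OF no_single_cycle, of p q Z] pq Z by auto
  qed
qed

lemma level_top_eq: "lev (card X) = (real (card S))\<^sup>2"
proof (cases "S = {}")
  case True
  then show ?thesis by (simp add: level_def ip_def amplitude_def)
next
  case False
  then obtain p0 where p0: "p0 \<in> S" by blast
  show ?thesis by (rule level_top[OF same_sign[OF _ p0] inversion_sign_sq])
qed

lemma sum_card_restrict:
  assumes "x \<in> X"
  shows "(\<Sum>y\<in>Y. card {p \<in> S. p x = y}) = card S"
proof -
  have "(\<Sum>y\<in>Y. card {p \<in> S. p x = y}) = card (\<Union>y\<in>Y. {p \<in> S. p x = y})"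
    by (rule card_UN_disjoint[symmetric]) (use finite_Y finite_S in auto)
  also have "(\<Union>y\<in>Y. {p \<in> S. p x = y}) = S" using maps assms by auto
  finally show ?thesis .
qed

text \<open>The induction step. The bound for the subfamilies is linear in their size so that, for
  each x, their sizes add up to \<open>card S\<close>.\<close>

lemma total_level_step:
  assumes card: "2 \<le> card X"
    and c: "\<And>x y. x \<in> X \<Longrightarrow> y \<in> Y \<Longrightarrow>
      total_level (X - {x}) (Y - {y}) {p \<in> S. p x = y} \<le> c * real (card {p \<in> S. p x = y})"
  shows "tot \<le> 2 * (real (card S))\<^sup>2 + c * n * card S / 2"
proof -
  have ne: "X \<noteq> {}" using card by auto
  have "2 * tot - 2 * lev 0 - 2 * lev (card X) \<le> (\<Sum>j<card X. pair_level j)"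
    by (rule sum_pair_level_ge[OF card])
  also have "\<dots> = (\<Sum>x\<in>X. \<Sum>y\<in>Y. total_level (X - {x}) (Y - {y}) {p \<in> S. p x = y})"
    by (rule sum_total_level_restrict[OF ne, symmetric])
  also have "\<dots> \<le> (\<Sum>x\<in>X. \<Sum>y\<in>Y. c * real (card {p \<in> S. p x = y}))"
    by (intro sum_mono c)
  also have "\<dots> = (\<Sum>x\<in>X. c * real (\<Sum>y\<in>Y. card {p \<in> S. p x = y}))"
    by (simp add: sum_distrib_left)
  also have "\<dots> = (\<Sum>x\<in>X. c * real (card S))"
    by (intro sum.cong refl) (simp only: sum_card_restrict)
  finally show ?thesis unfolding level_zero level_top_eq by (simp add: algebra_simps)
qed

lemma total_level_lower_square:
  assumes "odd (card X)" "card X \<noteq> 1"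
  shows "8 * (real (card S))\<^sup>2 \<le> tot"
proof -
  \<comment> \<open>The class condition is applied with Z = \<open>X\<close>, where agreement
    outside Z is vacuous.\<close>
  have "\<exists>C. C \<noteq> {} \<and> C \<subset> X \<and> p ` C = q ` C" if "p \<in> S" "q \<in> S" for p q
  proof -
    have "2 \<le> card X" using assms by (cases "card X") auto
    moreover have "p ` X = q ` X" using bij[OF that(1)] bij[OF that(2)] by (simp add: bij_betw_def)
    ultimately show ?thesis using no_single_cycleD[OF no_single_cycle that, of X] by auto
  qed
  then have "4 * (lev 0 + lev (card X)) \<le> tot"
    using assms by (intro total_level_lower) auto
  then show ?thesis unfolding level_zero level_top_eq by simp
qed

end

text \<open>The induction alternates parities and carries a size bound together with a bound on the
  total level. Passing to even n multiplies the size bound by n. Passing to odd n multiplies it by n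
  / 2, thanks to \<open>total_level_lower_square\<close>. The constants 8 and 6 reproduce
  themselves: 2 + 8 / 2 = 6, and 2 * (1 / 2) + 6 / 2 = 8 / 2.\<close>

lemma acyclic_family_bound_odd_even:
  fixes X :: "'a::linorder set" and Y :: "'b::linorder set"
  shows "(acyclic_family X Y S \<longrightarrow> card X = 2 * k + 1 \<longrightarrow>
      real (card S) \<le> fact (card X) / 2 ^ k \<and> total_level X Y S \<le> 8 * fact (card X) / 2 ^ k * card S) \<and>
    (acyclic_family X Y S \<longrightarrow> card X = 2 * k + 2 \<longrightarrow>
      real (card S) \<le> fact (card X) / 2 ^ k \<and> total_level X Y S \<le> 6 * fact (card X) / 2 ^ k * card S)"
proof -
  define odd_bound where "odd_bound = (\<lambda>k. \<forall>(X :: 'a set) (Y :: 'b set) S. acyclic_family X Y S \<longrightarrow> card X = 2 * k + 1 \<longrightarrow>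
      real (card S) \<le> fact (card X) / 2 ^ k \<and> total_level X Y S \<le> 8 * fact (card X) / 2 ^ k * card S)"
  define even_bound where "even_bound = (\<lambda>k. \<forall>(X :: 'a set) (Y :: 'b set) S. acyclic_family X Y S \<longrightarrow> card X = 2 * k + 2 \<longrightarrow>
      real (card S) \<le> fact (card X) / 2 ^ k \<and> total_level X Y S \<le> 6 * fact (card X) / 2 ^ k * card S)"
  have base: "odd_bound 0"
    unfolding odd_bound_def
  proof (intro allI impI)
    fix X :: "'a set" and Y :: "'b set" and S
    assume "acyclic_family X Y S" and c: "card X = 2 * 0 + 1"
    then interpret acyclic_family X Y S by simp
    obtain x where X: "X = {x}" using c by (auto simp: card_1_singleton_iff)
    obtain y where Y: "Y = {y}" using c card_Y by (auto simp: card_1_singleton_iff)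
    have "p = q" if "p \<in> S" "q \<in> S" for p q
    proof
      fix z show "p z = q z"
        using same_outside[OF that, of z] maps[OF that(1), of x] maps[OF that(2), of x] X Y by (cases "z = x") auto
    qed
    then have 1: "card S \<le> 1" using card_le_Suc0_iff_eq[OF finite_S] by auto
    have "tot = lev 0 + lev (card X)" unfolding total_level_def using c by simp
    also have "\<dots> = 2 * (real (card S))\<^sup>2" unfolding level_zero level_top_eq by simp
    also have "\<dots> = 2 * (real (card S))"
      using 1 by (cases "card S = 0") (auto simp: le_Suc_eq)
    finally show "real (card S) \<le> fact (card X) / 2 ^ 0 \<and> tot \<le> 8 * fact (card X) / 2 ^ 0 * card S"
      using 1 c by simp
  qed
  have to_even: "even_bound k" if "odd_bound k" for k
    unfolding even_bound_def
  proof (intro allI impI)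
    fix X :: "'a set" and Y :: "'b set" and S
    assume "acyclic_family X Y S" and c: "card X = 2 * k + 2"
    then interpret acyclic_family X Y S by simp
    define F where "F = fact (2 * k + 1) / (2 :: real) ^ k"
    have F: "fact (card X) / 2 ^ k = n * F" by (simp add: c F_def)
    have sub: "real (card {p \<in> S. p x = y}) \<le> F"
      "total_level (X - {x}) (Y - {y}) {p \<in> S. p x = y} \<le> 8 * F * card {p \<in> S. p x = y}" if "x \<in> X" "y \<in> Y" for x y
    proof -
      have "card (X - {x}) = 2 * k + 1" using c that by simp
      then show "real (card {p \<in> S. p x = y}) \<le> F"
        "total_level (X - {x}) (Y - {y}) {p \<in> S. p x = y} \<le> 8 * F * card {p \<in> S. p x = y}"
        using \<open>odd_bound k\<close> restrict[OF that] unfolding odd_bound_def F_def by (simp_all del: fact_Suc)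
    qed
    obtain x where x: "x \<in> X" using c by fastforce
    have "real (card S) = (\<Sum>y\<in>Y. real (card {p \<in> S. p x = y}))"
      unfolding sum_card_restrict[OF x, symmetric] by simp
    also have "\<dots> \<le> (\<Sum>y\<in>Y. F)" by (intro sum_mono sub x)
    finally have S: "real (card S) \<le> n * F" by (simp add: card_Y)
    have "tot \<le> 2 * (real (card S))\<^sup>2 + 8 * F * n * card S / 2"
      by (rule total_level_step) (use c sub in auto)
    also have "\<dots> \<le> 2 * (n * F * card S) + 8 * F * n * card S / 2"
      using mult_right_mono[OF S, of "real (card S)"] by (simp add: power2_eq_square mult_ac)
    finally have "tot \<le> 6 * (n * F) * card S" by (simp add: mult_ac)
    then show "real (card S) \<le> fact (card X) / 2 ^ k \<and> tot \<le> 6 * fact (card X) / 2 ^ k * card S"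
      using S by (simp add: F flip: times_divide_eq_right)
  qed
  have to_odd: "odd_bound (Suc k)" if "even_bound k" for k
    unfolding odd_bound_def
  proof (intro allI impI)
    fix X :: "'a set" and Y :: "'b set" and S
    assume "acyclic_family X Y S" and c: "card X = 2 * Suc k + 1"
    then interpret acyclic_family X Y S by simp
    define F where "F = fact (2 * k + 2) / (2 :: real) ^ k"
    have F: "fact (card X) / 2 ^ Suc k = n * F / 2" by (simp add: c F_def)
    have sub: "total_level (X - {x}) (Y - {y}) {p \<in> S. p x = y} \<le> 6 * F * card {p \<in> S. p x = y}"
      if "x \<in> X" "y \<in> Y" for x y
    proof -
      have "card (X - {x}) = 2 * k + 2" using c that by simp
      then show ?thesis
        using \<open>even_bound k\<close> restrict[OF that] unfolding even_bound_def F_def by (simp del: fact_Suc)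
    qed
    have step: "tot \<le> 2 * (real (card S))\<^sup>2 + 6 * F * n * card S / 2"
      by (rule total_level_step) (use c sub in auto)
    moreover have "8 * (real (card S))\<^sup>2 \<le> tot"
      by (rule total_level_lower_square) (use c in auto)
    \<comment> \<open>With s = \<open>card S\<close>, the two estimates give
      \<open>8 * s^2 <= 2 * s^2 + 3 * n * F * s\<close>, hence \<open>s^2 <= n * F / 2 * s\<close>;
      this is the source of the factor 2 gained per two points.\<close>
    ultimately have SS: "real (card S) * real (card S) \<le> (n * F / 2) * real (card S)"
      by (simp add: power2_eq_square mult_ac)
    then have S: "real (card S) \<le> n * F / 2"
    proof (cases "card S = 0")
      case False
      then show ?thesis by (intro mult_right_le_imp_le[OF SS]) simp
    qed (simp add: F_def del: fact_Suc)
    have "tot \<le> 2 * (n * F / 2 * card S) + 6 * F * n * card S / 2"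
      using step mult_right_mono[OF S, of "real (card S)"] by (simp add: power2_eq_square mult_ac)
    then have "tot \<le> 8 * (n * F / 2) * card S" by (simp add: mult_ac)
    then show "real (card S) \<le> fact (card X) / 2 ^ Suc k \<and> tot \<le> 8 * fact (card X) / 2 ^ Suc k * card S"
      using S by (simp add: F del: power_Suc fact_Suc flip: times_divide_eq_right)
  qed
  have "odd_bound k" by (induction k) (auto intro: base to_even to_odd)
  then show ?thesis using to_even unfolding odd_bound_def even_bound_def by blast
qed

lemma acyclic_family_card:
  assumes "acyclic_family X Y S" "card X = 2 * k + 1 \<or> card X = 2 * k + 2"
  shows "real (card S) \<le> fact (card X) / 2 ^ k"
  using acyclic_family_bound_odd_even[of X Y S k] assms by blast

section \<open>From simple cycle free labelings to classes of permutations\<close>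

lemma ends_eq_iff: "ends e = ends e' \<longleftrightarrow> e = e'"
  unfolding ends_def by (auto simp: doubleton_eq_iff prod_eq_iff)

lemma bit_vec_add_self: "(v :: bit ^ 'd) + v = 0"
  by (simp add: vec_eq_iff)

text \<open>If Z did not split, \<open>inv q o p\<close> would be one cycle on Z, and following
  p-edges and q-edges alternately would trace a simple cycle. Its label sum is 0: the two matchings
  have equal totals and agree outside Z, so their sums over Z are equal and cancel in characteristic
  2.\<close>

lemma simple_cycle_free_splits:
  fixes \<gamma> :: "nat \<times> nat \<Rightarrow> bit ^ 'd::finite"
  assumes free: "simple_cycle_free n \<gamma>"
    and p: "p permutes {1..n}" and q: "q permutes {1..n}"
    and sums: "(\<Sum>x\<in>{1..n}. \<gamma> (x, p x)) = (\<Sum>x\<in>{1..n}. \<gamma> (x, q x))"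
    and Z: "Z \<subseteq> {1..n}" "2 \<le> card Z" "p ` Z = q ` Z" and eq: "\<forall>x\<in>{1..n} - Z. p x = q x"
  shows "\<exists>C. C \<noteq> {} \<and> C \<subset> Z \<and> p ` C = q ` C"
proof (rule ccontr)
  assume "\<not> ?thesis"
  then have min: "C = Z" if "C \<noteq> {}" "C \<subseteq> Z" "p ` C = q ` C" for C using that by blast
  \<comment> \<open>t leads from a left vertex along its p-edge and back along a q-edge to the next
    left vertex.\<close>
  define t where "t = inv q \<circ> p"
  have finZ: "finite Z" using Z finite_subset by blast
  have tperm: "t permutes {1..n}" unfolding t_def by (intro permutes_compose p permutes_inv q)
  then have permt: "permutation t" by (auto simp: permutation_permutes)
  have qt: "q (t x) = p x" for x unfolding t_def using permutes_inverses(1)[OF q] by simp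
  have tZ: "t ` Z \<subseteq> Z"
  proof
    fix z assume "z \<in> t ` Z"
    then obtain x where x: "x \<in> Z" "z = t x" by auto
    then obtain y where "y \<in> Z" "p x = q y" using Z(3) by blast
    then show "z \<in> Z" using x permutes_inverses(2)[OF q] by (simp add: t_def)
  qed
  obtain x0 where x0: "x0 \<in> Z" using Z(2) by fastforce
  define r where "r = least_power t x0"
  define x where "x = (\<lambda>i. (t ^^ i) x0)"
  have r: "r > 0" "x r = x 0"
    using least_power_of_permutation[OF permt, of x0] by (auto simp: r_def x_def)
  have xSuc: "x (Suc i) = t (x i)" for i by (simp add: x_def)
  have xmod: "x (Suc j mod r) = t (x j)" if "j < r" for j
    using that r xSuc[of j] by (cases "Suc j = r") auto
  have xZ: "x i \<in> Z" for i
    by (induction i) (use x0 tZ xSuc in \<open>auto simp: x_def\<close>)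
  have dist: "inj_on x {..<r}"
    using cycle_of_permutation[OF permt, of x0] by (simp add: distinct_map r_def x_def lessThan_atLeast0)
  \<comment> \<open>The orbit of \<open>x0\<close> is invariant under t, so p and q have the same
    image on it; minimality then makes it all of Z.\<close>
  define orb where "orb = x ` {..<r}"
  have tO: "t ` orb = orb"
  proof (rule card_subset_eq)
    show "t ` orb \<subseteq> orb"
    proof (rule image_subsetI)
      fix z assume "z \<in> orb"
      then obtain j where j: "j < r" "z = x j" by (auto simp: orb_def)
      then have "t z = x (Suc j mod r)" using xmod by simp
      then show "t z \<in> orb" using r(1) by (simp add: orb_def)
    qed
    show "card (t ` orb) = card orb"
      by (rule card_image) (use permutes_inj[OF tperm] in \<open>auto simp: inj_on_def inj_def\<close>)
  qed (simp add: orb_def)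
  have "p ` orb = q ` orb"
  proof -
    have "p ` orb = q ` (t ` orb)" by (simp add: image_image qt)
    then show ?thesis by (simp add: tO)
  qed
  then have OZ: "orb = Z"
    using xZ r by (intro min) (auto simp: orb_def)
  have cr: "card Z = r" using card_image[OF dist] by (simp add: OZ[symmetric] orb_def)
  \<comment> \<open>Even positions hold the orbit points on the left, odd positions their p-partners
    on the right; the p-partner of one point is the q-partner of the next.\<close>
  define vs where "vs = map (\<lambda>i. if even i then Inl (x (i div 2)) else Inr (p (x (i div 2)))) [0..<2 * r]"
  have len: "length vs = 2 * r" by (simp add: vs_def)
  have pinj: "p a = p b \<longleftrightarrow> a = b" for a b using permutes_inj[OF p] by (auto simp: inj_def)
  have xinj: "x i = x j \<longleftrightarrow> i = j" if "i < r" "j < r" for i j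
    using inj_on_eq_iff[OF dist] that by simp
  have "distinct vs"
    unfolding vs_def distinct_map
  proof (intro conjI inj_onI)
    fix i j
    assume ij: "i \<in> set [0..<2 * r]" "j \<in> set [0..<2 * r]"
      and e: "(if even i then Inl (x (i div 2)) else Inr (p (x (i div 2)))) =
        (if even j then Inl (x (j div 2)) else Inr (p (x (j div 2))))"
    have "even i = even j" using e by (auto split: if_splits)
    moreover have "x (i div 2) = x (j div 2)" using e by (auto split: if_splits simp: pinj)
    then have "i div 2 = j div 2" using ij by (subst (asm) xinj) auto
    ultimately show "i = j" by (metis even_two_times_div_two odd_two_times_div_two_succ)
  qed simp
  have step_even: "cycle_step vs (2 * j) = ends (x j, p (x j))" if "j < r" for j
    using that r by (simp add: cycle_step_def ends_def len vs_def)
  \<comment> \<open>The edge leaving a right vertex is the q-edge of the next orbit point. The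
    reduction modulo r closes the walk after the last one.\<close>
  have step_odd: "cycle_step vs (Suc (2 * j)) = ends (x (Suc j mod r), q (x (Suc j mod r)))" if "j < r" for j
  proof -
    have "Suc (Suc (2 * j)) mod (2 * r) = 2 * (Suc j mod r)"
      using mult_mod_right[of 2 "Suc j" r] by simp
    moreover have "Suc j mod r < r" using r by simp
    ultimately show ?thesis
      using that by (auto simp: cycle_step_def ends_def len vs_def xmod qt)
  qed
  define E where "E = (\<lambda>z. (z, p z)) ` Z \<union> (\<lambda>z. (z, q z)) ` Z"
  have pq_in: "(z, p z) \<in> Knn_edges n" "(z, q z) \<in> Knn_edges n" if "z \<in> Z" for z
    using that Z(1) permutes_in_image[OF p] permutes_in_image[OF q] by (auto simp: Knn_edges_def simp del: atLeastAtMost_iff)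
  have step: "\<exists>e\<in>E. ends e = cycle_step vs i" if "i < length vs" for i
  proof (cases "even i")
    case True
    then obtain j where "i = 2 * j" by (elim evenE)
    then show ?thesis using that step_even[of j] xZ by (auto simp: len E_def)
  next
    case False
    then obtain j where "i = Suc (2 * j)" by (elim oddE) simp
    then show ?thesis using that step_odd[of j] xZ by (auto simp: len E_def)
  qed
  have EK: "E \<subseteq> Knn_edges n" using pq_in by (auto simp: E_def)
  have "simple_cycle n vs"
    unfolding simple_cycle_def using Z(2) cr len \<open>distinct vs\<close> step EK by blast
  have "cycle_edges n vs = E"
  proof
    show "cycle_edges n vs \<subseteq> E"
    proof
      fix e assume "e \<in> cycle_edges n vs"
      then obtain i where i: "i < length vs" "ends e = cycle_step vs i" by (auto simp: cycle_edges_def)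
      then obtain e' where "e' \<in> E" "ends e' = ends e" using step[of i] by auto
      then show "e \<in> E" by (simp add: ends_eq_iff)
    qed
    show "E \<subseteq> cycle_edges n vs"
    proof
      fix e assume e: "e \<in> E"
      then consider z where "z \<in> Z" "e = (z, p z)" | z where "z \<in> Z" "e = (z, q z)" by (auto simp: E_def)
      then have "\<exists>i<length vs. ends e = cycle_step vs i"
      proof cases
        case 1
        then obtain j where "j < r" "z = x j" using OZ by (auto simp: orb_def)
        then show ?thesis using 1 step_even[of j] by (intro exI[of _ "2 * j"]) (simp add: len)
      next
        case 2
        then have "z \<in> t ` orb" using OZ tO by simp
        then obtain j where "j < r" "z = t (x j)" by (auto simp: orb_def)
        then show ?thesis using 2 step_odd[of j] xmod[of j] by (intro exI[of _ "Suc (2 * j)"]) (simp add: len)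
      qed
      then show "e \<in> cycle_edges n vs" using e EK by (auto simp: cycle_edges_def)
    qed
  qed
  moreover have "(\<Sum>e\<in>E. \<gamma> e) = 0"
  proof -
    \<comment> \<open>A point where p and q agree would by itself be an agreeing subset, proper
      because Z has at least two points. So the p-edges and q-edges over Z are disjoint and no label
      is lost in the set \<open>E\<close>.\<close>
    have ne: "p z \<noteq> q z" if "z \<in> Z" for z
    proof
      assume "p z = q z"
      then have "{z} = Z" using that by (intro min) auto
      then show False using Z(2) by auto
    qed
    have "(\<Sum>e\<in>E. \<gamma> e) = (\<Sum>e\<in>(\<lambda>z. (z, p z)) ` Z. \<gamma> e) + (\<Sum>e\<in>(\<lambda>z. (z, q z)) ` Z. \<gamma> e)"
      unfolding E_def by (rule sum.union_disjoint) (use finZ ne in auto)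
    also have "(\<Sum>e\<in>(\<lambda>z. (z, p z)) ` Z. \<gamma> e) = (\<Sum>z\<in>Z. \<gamma> (z, p z))"
      by (rule sum.reindex_cong[where l = "\<lambda>z. (z, p z)"]) (auto simp: inj_on_def)
    also have "(\<Sum>e\<in>(\<lambda>z. (z, q z)) ` Z. \<gamma> e) = (\<Sum>z\<in>Z. \<gamma> (z, q z))"
      by (rule sum.reindex_cong[where l = "\<lambda>z. (z, q z)"]) (auto simp: inj_on_def)
    also have "(\<Sum>z\<in>Z. \<gamma> (z, q z)) = (\<Sum>z\<in>Z. \<gamma> (z, p z))"
    proof -
      have split: "(\<Sum>z\<in>{1..n}. \<gamma> (z, s z)) = (\<Sum>z\<in>{1..n} - Z. \<gamma> (z, s z)) + (\<Sum>z\<in>Z. \<gamma> (z, s z))" for s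
        by (rule sum.subset_diff) (use Z(1) in auto)
      have "(\<Sum>z\<in>{1..n} - Z. \<gamma> (z, p z)) = (\<Sum>z\<in>{1..n} - Z. \<gamma> (z, q z))"
        by (rule sum.cong) (use eq in auto)
      then show ?thesis using sums split[of p] split[of q] by simp
    qed
    finally show ?thesis by (simp add: bit_vec_add_self)
  qed
  ultimately show False
    using free \<open>simple_cycle n vs\<close> unfolding simple_cycle_free_def by auto
qed

lemma card_UNIV_bit: "CARD(bit) = 2"
proof -
  have "(UNIV :: bit set) = {0, 1}" by (auto intro: bit.exhaust)
  then show ?thesis by (metis card_2_iff zero_neq_one)
qed

theorem theorem1p3:
  fixes n :: nat and \<gamma> :: "nat \<times> nat \<Rightarrow> bit ^ 'd::finite"
  assumes "n > 0"
    and "simple_cycle_free n \<gamma>"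
  shows "real CARD('d) \<ge> real n / 2 - 2"
proof -
  \<comment> \<open>This rounding covers both parities in the form required by
    \<open>acyclic_family_card\<close>.\<close>
  define k where "k = (n - 1) div 2"
  have k: "n = 2 * k + 1 \<or> n = 2 * k + 2" using assms(1) by (auto simp: k_def)
  define V where "V = (UNIV :: (bit ^ 'd) set)"
  have cV: "card V = 2 ^ CARD('d)" unfolding V_def by (simp add: card_UNIV_bit)
  have finV: "finite V" using cV card_ge_0_finite[of V] by simp
  \<comment> \<open>One class for each pair of a label sum and a sign, hence
    \<open>2 ^ (CARD('d) + 1)\<close> classes covering all permutations.\<close>
  define F where "F = (\<lambda>(v, s). {p. p permutes {1..n} \<and> (\<Sum>x\<in>{1..n}. \<gamma> (x, p x)) = v
    \<and> inversion_sign p {1..n} = s})"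
  have F: "acyclic_family {1..n} {1..n} (F c)" for c
  proof (cases c)
    case (Pair v s)
    show ?thesis
    proof unfold_locales
      show "finite (F c)"
        by (rule finite_subset[OF _ finite_permutations[of "{1..n}"]]) (auto simp: F_def)
      show "bij_betw p {1..n} {1..n}" if "p \<in> F c" for p
        using that permutes_imp_bij by (auto simp: F_def Pair)
      show "p x = q x" if "p \<in> F c" "q \<in> F c" "x \<notin> {1..n}" for p q x
        using that by (auto simp: F_def Pair permutes_def)
      show "inversion_sign p {1..n} = inversion_sign q {1..n}" if "p \<in> F c" "q \<in> F c" for p q
        using that by (auto simp: F_def Pair)
      show "no_single_cycle {1..n} (F c)"
        unfolding no_single_cycle_def
      proof (intro ballI allI impI)
        fix p q Z
        assume "p \<in> F c" "q \<in> F c" "Z \<subseteq> {1..n}" "2 \<le> card Z" "p ` Z = q ` Z" "\<forall>x\<in>{1..n} - Z. p x = q x"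
        then show "\<exists>C. C \<noteq> {} \<and> C \<subset> Z \<and> p ` C = q ` C"
          by (intro simple_cycle_free_splits[OF assms(2), of p q Z]) (auto simp: F_def Pair)
      qed
    qed auto
  qed
  have "{p. p permutes {1..n}} \<subseteq> (\<Union>c\<in>V \<times> {1, -1}. F c)"
    using inversion_sign_cases[of _ "{1..n}"] by (auto simp: F_def V_def)
  then have "card {p. p permutes {1..n}} \<le> card (\<Union>c\<in>V \<times> {1, -1}. F c)"
    using finV acyclic_family.axioms(1)[OF F] by (intro card_mono) (auto simp: bij_family_def)
  also have "\<dots> \<le> (\<Sum>c\<in>V \<times> {1, -1}. card (F c))"
    by (rule card_UN_le) (use finV in auto)
  finally have "fact n \<le> (\<Sum>c\<in>V \<times> {1, -1}. card (F c))"
    using card_permutations[of "{1..n}" n] by simp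
  then have "real (fact n) \<le> real (\<Sum>c\<in>V \<times> {1, -1}. card (F c))"
    by (simp only: of_nat_le_iff)
  also have "\<dots> \<le> (\<Sum>c\<in>V \<times> {1, -1 :: real}. fact n / 2 ^ k)"
    unfolding of_nat_sum using acyclic_family_card[OF F, of k] k by (intro sum_mono) auto
  also have "\<dots> = 2 ^ (CARD('d) + 1) * (fact n / 2 ^ k)"
    by (simp add: card_cartesian_product cV)
  \<comment> \<open>The \<open>fact n\<close> permutations lie in these classes of size at most
    \<open>fact n / 2 ^ k\<close>; cancelling \<open>fact n\<close> leaves the comparison of powers
    of 2.\<close>
  finally have "(2 :: real) ^ k \<le> 2 ^ (CARD('d) + 1)"
    by (simp add: field_simps)
  then have "k \<le> CARD('d) + 1" by (simp only: power_increasing_iff one_less_numeral_iff semiring_norm)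
  then have "real k \<le> real CARD('d) + 1" by linarith
  moreover have "real n \<le> 2 * real k + 2" using k by auto
  ultimately show ?thesis by linarith
qed

end
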